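(* Let $\Omega_2=\{(x,y)\in\mathbb{R}^2:|x|<1,\ |y|<1\}$ and, for $s\in(0,1)$, let $$w_{2,s}(x,y)=\sum_{k,m=0}^{\infty}\frac{(2/\pi)^{2s}}{[(2k+1)^2+(2m+1)^2]^s}\cos\left[\frac{(2k+1)\pi x}{2}\right]\cos\left[\frac{(2m+1)\pi y}{2}\right]$$ be the solution of the spectral fractional problem $(-\Delta)^s w=\delta_0$ in $\Omega_2$ with homogeneous Dirichlet conditions on $\partial\Omega_2$. Then: (a) $w_{2,s}\in L_2(\Omega_2)$ if and only if $s\in(1/2,1)$. (b) For all $s\in(0,1)$, $$w_{2,s}(0,0)=\left(\frac{2}{\pi}\right)^{2s}\sum_{k,m=0}^{\infty}\frac{1}{[(2k+1)^2+(2m+1)^2]^s}=+\infty,$$ which means that the spectral solution $w_{2,s}$ with homogeneous Dirichlet data, like the fundamental solution $u_0(x,y)=a(2,s)(x^2+y^2)^{-1+s}$ of the Riesz formulation, is always unbounded. (c) $w_{2,s}\in C\left(\overline{\Omega}_2\setminus\{(0,0)\}\right)$ for $s\in(1/2,1)$.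
   Context: Spectral fractional Laplacian with zero Dirichlet data on the square $\Omega_2=(-1,1)^2$: let $\lambda_{k,m}=(k^2+m^2)\frac{\pi^2}{4}$ and $e_{k,m}(x,y)=\sin\left[\frac{k\pi}{2}(x+1)\right]\sin\left[\frac{m\pi}{2}(y+1)\right]$, $k,m=1,2,\dots$, be the eigenvalues and $L_2(\Omega_2)$-orthonormal eigenfunctions of $-\Delta$ on $\Omega_2$ with homogeneous Dirichlet conditions. Then $(-\Delta_{\Omega_2,0})^s w:=\sum_{k,m\ge1}\lambda_{k,m}^s(w,e_{k,m})_{L_2(\Omega_2)}e_{k,m}$. The Dirac function $\delta_0$ at the origin, $\langle\delta_0,\varphi\rangle=\varphi(0,0)$, is identified with its expansion $\sum_{k,m\ge1}\langle\delta_0,e_{k,m}\rangle e_{k,m}$; the solution $w_{2,s}$ is the series obtained by equating coefficients in $(-\Delta_{\Omega_2,0})^s w=\delta_0$, i.e. $w_{2,s}=\sum_{k,m\ge0}\frac{(-1)^{k+m}}{\lambda_{2k+1,2m+1}^s}e_{2k+1,2m+1}$, which is the cosine series displayed in the claim. The constant in the fundamental solution of $(-\Delta)^s u=\delta_0$ in $\mathbb{R}^2$ is $a(2,s)=\frac{\Gamma(1-s)}{2^{2s}\pi\,\Gamma(s)}$. Convention: $w_{2,s}\in L_2(\Omega_2)$ means that the series converges in $L_2(\Omega_2)$. Pointwise values of the double series, with $k,m\ge0$ the summation indices of the cosine series, are understood as limits as $K\to\infty$ ($K\in\mathbb{N}$) of the partial sums over $k^2+m^2<2K^2$; $w_{2,s}\in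 C(A)$ means that these partial sums converge at every point of $A$ and the limit is a continuous function on $A$. At the origin all terms are positive, and the value $+\infty$ means that the series diverges. *)

theory Defs
  imports "HOL-Analysis.Analysis"
begin

definition Omega2 :: "(real \<times> real) set" where
  "Omega2 = {(x, y). \<bar>x\<bar> < 1 \<and> \<bar>y\<bar> < 1}"

text \<open>Dirichlet eigenpairs of the negative Laplacian on the square, meant for indices
  \<open>k, m \<ge> 1\<close>.\<close>

definition eigval :: "nat \<Rightarrow> nat \<Rightarrow> real" where
  "eigval k m = (real k ^ 2 + real m ^ 2) * (pi ^ 2 / 4)"

definition eigfun :: "nat \<Rightarrow> nat \<Rightarrow> real \<times> real \<Rightarrow> real" where
  "eigfun k m = (\<lambda>(x, y). sin (real k * pi / 2 * (x + 1)) * sin (real m * pi / 2 * (y + 1)))"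

definition dirac0 :: "(real \<times> real \<Rightarrow> real) \<Rightarrow> real" where
  "dirac0 \<phi> = \<phi> (0, 0)"

definition inner_L2 :: "(real \<times> real \<Rightarrow> real) \<Rightarrow> (real \<times> real \<Rightarrow> real) \<Rightarrow> real" where
  "inner_L2 f g = (LINT p|lebesgue_on Omega2. f p * g p)"

definition in_L2 :: "(real \<times> real \<Rightarrow> real) \<Rightarrow> bool" where
  "in_L2 f \<longleftrightarrow> f \<in> borel_measurable (lebesgue_on Omega2) \<and>
     integrable (lebesgue_on Omega2) (\<lambda>p. (f p) ^ 2)"

text \<open>Convergence of a series of functions in \<open>L\<^sub>2(\<Omega>\<^sub>2)\<close>, along the net of finite partial sums.
  For series of pairwise orthogonal functions, such as the ones considered here, this does not
  differ from convergence along any fixed exhaustion of the index set by finite sets.\<close>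

definition has_sum_L2 :: "('i \<Rightarrow> real \<times> real \<Rightarrow> real) \<Rightarrow> (real \<times> real \<Rightarrow> real) \<Rightarrow> bool" where
  "has_sum_L2 u f \<longleftrightarrow> (\<forall>i. in_L2 (u i)) \<and> in_L2 f \<and>
     ((\<lambda>F. let d = (\<lambda>p. (\<Sum>i\<in>F. u i p) - f p) in sqrt (inner_L2 d d)) \<longlongrightarrow> 0)
       (finite_subsets_at_top UNIV)"

definition summable_L2 :: "('i \<Rightarrow> real \<times> real \<Rightarrow> real) \<Rightarrow> bool" where
  "summable_L2 u \<longleftrightarrow> (\<exists>f. has_sum_L2 u f)"

text \<open>An expansion in the eigenfunctions is represented by its family \<open>c\<close> of coefficients (the
  values \<open>c k m\<close> with \<open>k, m \<ge> 1\<close> matter), since neither the Dirac function nor, for small \<open>s\<close>,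
  the solution is in \<open>L\<^sub>2(\<Omega>\<^sub>2)\<close>. For \<open>w\<close> in \<open>L\<^sub>2(\<Omega>\<^sub>2)\<close> the coefficients are
  \<open>inner_L2 w (eigfun k m)\<close>. The spectral power of order \<open>s\<close> acts by multiplication with
  \<open>eigval k m powr s\<close>.\<close>

definition spectral_power :: "real \<Rightarrow> (nat \<Rightarrow> nat \<Rightarrow> real) \<Rightarrow> nat \<Rightarrow> nat \<Rightarrow> real" where
  "spectral_power s c k m = eigval k m powr s * c k m"

definition spectral_dirac_solution :: "real \<Rightarrow> (nat \<Rightarrow> nat \<Rightarrow> real) \<Rightarrow> bool" where
  "spectral_dirac_solution s c \<longleftrightarrow>
     (\<forall>k\<ge>1. \<forall>m\<ge>1. spectral_power s c k m = dirac0 (eigfun k m))"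

definition w_term :: "real \<Rightarrow> nat \<times> nat \<Rightarrow> real \<times> real \<Rightarrow> real" where
  "w_term s = (\<lambda>(k, m) (x, y).
     (2 / pi) powr (2 * s) / ((2 * real k + 1) ^ 2 + (2 * real m + 1) ^ 2) powr s
     * cos ((2 * real k + 1) * pi * x / 2) * cos ((2 * real m + 1) * pi * y / 2))"

definition w_partial :: "real \<Rightarrow> nat \<Rightarrow> real \<times> real \<Rightarrow> real" where
  "w_partial s K p = (\<Sum>i\<in>{(k, m). k ^ 2 + m ^ 2 < 2 * K ^ 2}. w_term s i p)"

definition w_has_value :: "real \<Rightarrow> real \<times> real \<Rightarrow> ereal \<Rightarrow> bool" where
  "w_has_value s p v \<longleftrightarrow> (\<lambda>K. ereal (w_partial s K p)) \<longlonglongrightarrow> v"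

definition w_continuous_on :: "real \<Rightarrow> (real \<times> real) set \<Rightarrow> bool" where
  "w_continuous_on s A \<longleftrightarrow>
     (\<exists>f :: real \<times> real \<Rightarrow> real. (\<forall>p\<in>A. w_has_value s p (ereal (f p))) \<and> continuous_on A f)"

text \<open>An expansion is bounded if it is the expansion of a bounded measurable function. This
  does not refer to pointwise values, which need not exist away from the origin for small \<open>s\<close>,
  and it is not affected by a single value such as the one at the origin.\<close>

definition bounded_expansion :: "(nat \<Rightarrow> nat \<Rightarrow> real) \<Rightarrow> bool" where
  "bounded_expansion c \<longleftrightarrow>
     (\<exists>g. g \<in> borel_measurable (lebesgue_on Omega2) \<and> bounded (g ` Omega2) \<and>
        (\<forall>k\<ge>1. \<forall>m\<ge>1. inner_L2 g (eigfun k m) = c k m))"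

definition riesz_const2 :: "real \<Rightarrow> real" where
  "riesz_const2 s = Gamma (1 - s) / (2 powr (2 * s) * pi * Gamma s)"

definition riesz_fundamental :: "real \<Rightarrow> real \<times> real \<Rightarrow> real" where
  "riesz_fundamental s = (\<lambda>(x, y). riesz_const2 s * (x ^ 2 + y ^ 2) powr (- 1 + s))"

end

theory Submission
  imports Defs
begin

text \<open>
  The coefficients on frequencies \<open>(2k+1, 2m+1)\<close> are of size \<open>(k + m)\<close> to the power \<open>-2s\<close>; their sum
  over a square grows at least like the harmonic numbers when \<open>s \<le> 1\<close>, and they are square
  summable exactly for \<open>s > 1/2\<close>. Away from the origin one of the sines \<open>sin (\<pi>x/2)\<close>, \<open>sin (\<pi>y/2)\<close>
  does not vanish, say the second; Abel summation in \<open>m\<close> then bounds each column of the cosine series by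
  its first coefficient, uniformly in the height of the column, and for \<open>s > 1/2\<close> these
  coefficients are summable over the columns, so that Tannery's theorem applies. The limit is also
  the \<open>L\<^sub>2\<close> sum, by Fatou's lemma. A bounded function with these coefficients
  cannot exist, since testing it against products of positive Fejer-type kernels, whose \<open>L\<^sub>1\<close> norms
  are bounded, would bound the divergent sum of the coefficients.
\<close>

section \<open>Coefficients of the cosine series\<close>

text \<open>The index is real rather than natural, because the kernels used for testing run through
  differences \<open>real i - real j\<close>, which may be negative. The same holds for
  \<open>w_coeff\<close>.\<close>

definition odd_cos :: "real \<Rightarrow> real \<Rightarrow> real" where
  "odd_cos l x = cos ((2 * l + 1) * pi * x / 2)"

definition w_coeff :: "real \<Rightarrow> real \<Rightarrow> real \<Rightarrow> real" where
  "w_coeff s u v = (2 / pi) powr (2 * s) / ((2 * u + 1) ^ 2 + (2 * v + 1) ^ 2) powr s"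

lemma w_term_eq: "w_term s (k, m) (x, y) = w_coeff s k m * (odd_cos k x * odd_cos m y)"
  by (simp add: w_term_def w_coeff_def odd_cos_def)

text \<open>Moving the origin to the centre of the square shifts the argument of each sine by
  \<open>pi / 2 + j * pi\<close>; the quarter period turns sine into cosine and the rest leaves a
  sign.\<close>

lemma eigfun_odd:
  "eigfun (2 * k + 1) (2 * m + 1) (x, y) = (-1) ^ (k + m) * (odd_cos k x * odd_cos m y)"
proof -
  have "sin (real (2 * j + 1) * pi / 2 * (z + 1)) = (-1) ^ j * odd_cos j z" for j z
  proof -
    have "real (2 * j + 1) * pi / 2 * (z + 1) = ((2 * real j + 1) * pi * z / 2 + pi / 2) + real j * pi"
      by (simp add: field_simps)
    then have "sin (real (2 * j + 1) * pi / 2 * (z + 1))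
        = sin ((2 * real j + 1) * pi * z / 2 + pi / 2) * cos (real j * pi)"
      by (simp only: sin_add) (simp add: sin_npi)
    then show ?thesis
      by (simp add: odd_cos_def sin_add cos_npi)
  qed
  then show ?thesis
    by (simp add: eigfun_def power_add)
qed

lemma power2_powr:
  fixes x :: real
  assumes "x > 0"
  shows "(x ^ 2) powr s = x powr (2 * s)"
  using powr_powr [of x 2 s] assms by simp

text \<open>The factor \<open>(pi / 2) ^ 2\<close> of the eigenvalue, raised to the power
  \<open>s\<close>, cancels the prefactor \<open>(2 / pi) powr (2 * s)\<close>. Multiplying by
  \<open>w_coeff\<close> thus inverts the spectral power.\<close>

lemma eigval_powr_odd: "eigval (2 * k + 1) (2 * m + 1) powr s * w_coeff s k m = 1"
proof -
  define r :: real where "r = (2 * real k + 1) ^ 2 + (2 * real m + 1) ^ 2"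
  have r: "r > 0" unfolding r_def by (intro add_pos_nonneg) auto
  have e: "eigval (2 * k + 1) (2 * m + 1) = r * (pi / 2) ^ 2"
    by (simp add: eigval_def r_def power_divide add.commute)
  have "(pi / 2) powr (2 * s) * (2 / pi) powr (2 * s) = 1"
    by (subst powr_mult [symmetric]) auto
  moreover have "((pi / 2) ^ 2) powr s = (pi / 2) powr (2 * s)"
    by (rule power2_powr) simp
  moreover have "w_coeff s k m = (2 / pi) powr (2 * s) / r powr s"
    by (simp add: w_coeff_def r_def)
  ultimately show ?thesis
    unfolding e using r by (simp add: powr_mult)
qed

lemma solution_odd:
  assumes "spectral_dirac_solution s c"
  shows "c (2 * k + 1) (2 * m + 1) = (-1) ^ (k + m) * w_coeff s k m"
proof -
  have "eigval (2 * k + 1) (2 * m + 1) powr s * c (2 * k + 1) (2 * m + 1) = (-1) ^ (k + m)"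
    using assms eigfun_odd [of k m 0 0]
    by (auto simp: spectral_dirac_solution_def spectral_power_def dirac0_def odd_cos_def)
  then have "(eigval (2 * k + 1) (2 * m + 1) powr s * w_coeff s k m) * c (2 * k + 1) (2 * m + 1)
      = (-1) ^ (k + m) * w_coeff s k m"
    by (simp only: mult_ac)
  then show ?thesis
    by (simp only: eigval_powr_odd mult_1)
qed

text \<open>For an even index the sine has a node at the centre, so the Dirac function does not see
  the eigenfunction; the eigenvalue is positive and can be divided out.\<close>

lemma solution_even:
  assumes "spectral_dirac_solution s c" "k \<ge> 1" "m \<ge> 1" "even k \<or> even m"
  shows "c k m = 0"
proof -
  have "sin (real j * pi / 2) = 0" if "even j" for j
    using that by (auto elim!: evenE simp: sin_npi)
  then have "dirac0 (eigfun k m) = 0"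
    using assms(4) by (auto simp: dirac0_def eigfun_def)
  moreover have "eigval k m > 0"
    using assms by (auto simp: eigval_def intro!: mult_pos_pos add_pos_nonneg)
  moreover have "eigval k m powr s * c k m = dirac0 (eigfun k m)"
    using assms by (auto simp: spectral_dirac_solution_def spectral_power_def)
  ultimately show ?thesis by simp
qed

lemma solution_term:
  assumes "spectral_dirac_solution s c"
  shows "c (2 * k + 1) (2 * m + 1) * eigfun (2 * k + 1) (2 * m + 1) p = w_term s (k, m) p"
proof -
  obtain x y where p: "p = (x, y)" by (cases p)
  \<comment> \<open>The sign occurs once in the coefficient and once in the eigenfunction.\<close>
  have "((-1::real) ^ (k + m)) * (-1) ^ (k + m) = 1"
    by (simp flip: power_mult_distrib)
  then show ?thesis
    unfolding p w_term_eq eigfun_odd solution_odd [OF assms]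
    by (simp add: mult_ac)
qed

section \<open>Size of the coefficients and thresholds for summability\<close>

lemma w_coeff_nonneg: "w_coeff s u v \<ge> 0"
  by (simp add: w_coeff_def)

lemma w_coeff_commute: "w_coeff s u v = w_coeff s v u"
  by (simp add: w_coeff_def add.commute)

lemma w_coeff_antimono:
  assumes "s \<ge> 0" "u \<ge> 0" "0 \<le> v" "v \<le> v'"
  shows "w_coeff s u v' \<le> w_coeff s u v"
proof -
  have "(2 * u + 1) ^ 2 + (2 * v + 1) ^ 2 > 0"
    using assms by (intro add_pos_nonneg) auto
  then show ?thesis
    unfolding w_coeff_def using assms
    by (intro divide_left_mono powr_mono2 add_left_mono power_mono mult_pos_pos) (auto simp: add_pos_nonneg)
qed

text \<open>The prefactor carries \<open>2 * s\<close> as well, so squaring is exactly doubling of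
  \<open>s\<close>. This turns the summability threshold 1 into the mean-square threshold
  1/2.\<close>

lemma w_coeff_power2: "w_coeff s u v ^ 2 = w_coeff (2 * s) u v"
proof -
  have "(a powr t) ^ 2 = a powr (2 * t)" for a t :: real
    by (simp add: power2_eq_square flip: powr_add)
  then show ?thesis
    by (simp add: w_coeff_def power_divide)
qed

text \<open>Dropping the square that contains \<open>m\<close> gives decay in \<open>k\<close>
  uniformly in \<open>m\<close>.\<close>

lemma w_coeff_le_powr:
  assumes "s \<ge> 0" "k \<ge> 0"
  shows "w_coeff s k m \<le> (2 / pi) powr (2 * s) * (k + 1) powr (- 2 * s)"
proof -
  have "(k + 1) powr (2 * s) = ((k + 1) ^ 2) powr s"
    using assms by (simp add: power2_powr)
  also have "(k + 1) ^ 2 \<le> (2 * k + 1) ^ 2"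
    using assms by (intro power_mono) auto
  then have "((k + 1) ^ 2) powr s \<le> ((2 * k + 1) ^ 2 + (2 * m + 1) ^ 2) powr s"
    using assms by (intro powr_mono2 add_increasing2) auto
  finally show ?thesis
    unfolding w_coeff_def using assms
    by (simp add: powr_minus divide_simps mult_left_mono)
qed

text \<open>The inequality between a product and a sum of squares separates the variables, so that
  the double series is dominated by a product of two single series.\<close>

lemma w_coeff_le_product:
  assumes "s \<ge> 0" "k \<ge> 0" "m \<ge> 0"
  shows "w_coeff s k m \<le> (2 / pi) powr (2 * s) * ((k + 1) powr - s * (m + 1) powr - s)"
proof -
  have "(k + 1) * (m + 1) \<le> (2 * k + 1) * (2 * m + 1)"
    using assms by (intro mult_mono) auto
  also have "\<dots> \<le> (2 * k + 1) ^ 2 + (2 * m + 1) ^ 2"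
    using sum_squares_bound [of "2 * k + 1" "2 * m + 1"] assms
      mult_nonneg_nonneg[of "2 * k + 1" "2 * m + 1"] by linarith
  finally have "((k + 1) * (m + 1)) powr s \<le> ((2 * k + 1) ^ 2 + (2 * m + 1) ^ 2) powr s"
    using assms by (intro powr_mono2) auto
  then have "(2 / pi) powr (2 * s) / ((2 * k + 1) ^ 2 + (2 * m + 1) ^ 2) powr s
      \<le> (2 / pi) powr (2 * s) / ((k + 1) * (m + 1)) powr s"
    using assms by (intro divide_left_mono mult_pos_pos) (auto simp: add_pos_nonneg)
  also have "\<dots> = (2 / pi) powr (2 * s) * ((k + 1) powr - s * (m + 1) powr - s)"
    using assms by (subst powr_mult) (auto simp: powr_minus divide_inverse)
  finally show ?thesis
    by (simp add: w_coeff_def)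
qed

lemma summable_on_w_coeff:
  assumes "s > 1"
  shows "(\<lambda>(k :: nat, m :: nat). w_coeff s k m) summable_on UNIV"
proof -
  have "summable (\<lambda>k. real (Suc k) powr - s)"
    using assms by (subst summable_Suc_iff) (simp add: summable_real_powr_iff)
  then have "(\<lambda>k. (real k + 1) powr - s) summable_on UNIV"
    by (subst summable_on_UNIV_nonneg_real_iff) (auto simp: add.commute)
  then have "(\<lambda>(k :: nat, m :: nat). (real k + 1) powr - s * (real m + 1) powr - s) summable_on UNIV \<times> UNIV"
    by (intro summable_on_SigmaI [where g = "\<lambda>k. (real k + 1) powr - s * (\<Sum>\<^sub>\<infinity>m. (real m + 1) powr - s)"])
       (auto intro!: has_sum_cmult_right summable_on_cmult_left)
  then have "(\<lambda>i. (2 / pi) powr (2 * s) * (case i of (k :: nat, m :: nat) \<Rightarrow>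
      (real k + 1) powr - s * (real m + 1) powr - s)) summable_on UNIV"
    by (intro summable_on_cmult_right) simp
  then show ?thesis
    by (rule summable_on_comparison_test)
       (use assms in \<open>auto simp: w_coeff_nonneg intro!: w_coeff_le_product\<close>)
qed

text \<open>Only the half \<open>m \<le> k\<close> of the square is kept: row \<open>k\<close> then
  has \<open>k + 1\<close> terms, each at least a constant over \<open>8 * (k + 1) ^ 2\<close>,
  which leaves a term of the harmonic series.\<close>

lemma sum_w_coeff_square_ge:
  assumes "0 \<le> s" "s \<le> 1"
  shows "(2 / pi) powr (2 * s) / 8 * harm n \<le> (\<Sum>k<n. \<Sum>m<n. w_coeff s (real k) (real m))"
proof -
  define b where "b = (2 / pi) powr (2 * s)"
  have b: "b > 0" by (simp add: b_def)
  have 1: "b / 8 * inverse (real (Suc k)) \<le> (\<Sum>m<n. w_coeff s (real k) (real m))" if "k < n" for k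
  proof -
    have 2: "b / (8 * (real k + 1) ^ 2) \<le> w_coeff s (real k) (real m)" if "m \<le> k" for m
    proof -
      define r where "r = (2 * real k + 1) ^ 2 + (2 * real m + 1) ^ 2"
      \<comment> \<open>For a base of at least 1 the exponent \<open>s \<le> 1\<close> may be raised
        to 1.\<close>
      have r1: "r \<ge> 1"
        unfolding r_def by (intro add_increasing2) auto
      have "r \<le> (2 * (real k + 1)) ^ 2 + (2 * (real k + 1)) ^ 2"
        unfolding r_def using that by (intro add_mono power_mono) auto
      then have "r \<le> 8 * (real k + 1) ^ 2"
        by (simp add: power2_eq_square algebra_simps)
      moreover have "r powr s \<le> r powr 1"
        using r1 assms by (intro powr_mono) auto
      ultimately show ?thesis
        using r1 b unfolding w_coeff_def by (fold r_def b_def) (intro divide_left_mono, auto)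
    qed
    have "b / 8 * inverse z = z * (b / (8 * z ^ 2))" if "z > 0" for z :: real
      using that by (simp add: field_simps power2_eq_square)
    from this [of "real k + 1"]
    have "b / 8 * inverse (real (Suc k)) = (\<Sum>m\<le>k. b / (8 * (real k + 1) ^ 2))"
      by (simp add: add.commute)
    also have "\<dots> \<le> (\<Sum>m\<le>k. w_coeff s (real k) (real m))"
      by (intro sum_mono 2) auto
    also have "\<dots> \<le> (\<Sum>m<n. w_coeff s (real k) (real m))"
      using that by (intro sum_mono2) (auto simp: w_coeff_nonneg)
    finally show ?thesis .
  qed
  have "b / 8 * harm n = (\<Sum>k<n. b / 8 * inverse (real (Suc k)))"
    unfolding harm_altdef by (simp add: sum_distrib_left)
  also have "\<dots> \<le> (\<Sum>k<n. \<Sum>m<n. w_coeff s (real k) (real m))"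
    by (intro sum_mono 1) auto
  finally show ?thesis by (simp add: b_def)
qed

lemma filterlim_sum_w_coeff_square:
  assumes "0 \<le> s" "s \<le> 1"
  shows "filterlim (\<lambda>n. \<Sum>k<n. \<Sum>m<n. w_coeff s (real k) (real m)) at_top sequentially"
proof (rule filterlim_at_top_mono)
  show "filterlim (\<lambda>n. (2 / pi) powr (2 * s) / 8 * harm n :: real) at_top sequentially"
    by (rule filterlim_tendsto_pos_mult_at_top [OF tendsto_const _ harm_at_top]) auto
qed (use sum_w_coeff_square_ge [OF assms] in auto)

lemma not_summable_on_w_coeff:
  assumes "0 \<le> s" "s \<le> 1"
  shows "\<not> (\<lambda>(k :: nat, m :: nat). w_coeff s k m) summable_on UNIV"
proof
  assume sm: "(\<lambda>(k :: nat, m :: nat). w_coeff s k m) summable_on UNIV"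
  define t where "t = (\<Sum>\<^sub>\<infinity>(k :: nat, m :: nat). w_coeff s k m)"
  have "(\<Sum>k<n. \<Sum>m<n. w_coeff s (real k) (real m)) \<le> t" for n
    unfolding t_def sum.cartesian_product
    by (rule finite_sum_le_infsum [OF sm]) (auto simp: w_coeff_nonneg)
  moreover have "\<exists>n. t < (\<Sum>k<n. \<Sum>m<n. w_coeff s (real k) (real m))"
    using filterlim_sum_w_coeff_square [OF assms]
    unfolding filterlim_at_top_dense by (meson eventually_happens sequentially_bot)
  ultimately show False
    by (meson not_le)
qed

text \<open>On the first axis the function is \<open>riesz_const2 s\<close> times a negative power
  of \<open>x\<close>, so any large value can be prescribed and solved for \<open>x\<close>.\<close>

lemma unbounded_riesz_fundamental:
  assumes "0 < s" "s < 1"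
  shows "\<not> bounded (riesz_fundamental s ` (Omega2 - {(0, 0)}))"
proof
  assume "bounded (riesz_fundamental s ` (Omega2 - {(0, 0)}))"
  then obtain B where B: "\<And>p. p \<in> Omega2 - {(0, 0)} \<Longrightarrow> \<bar>riesz_fundamental s p\<bar> \<le> B"
    unfolding bounded_iff by auto
  define a where "a = riesz_const2 s"
  have a: "a > 0"
    using assms by (simp add: a_def riesz_const2_def Gamma_real_pos)
  define t where "t = 2 - 2 * s"
  \<comment> \<open>The summand \<open>a\<close> forces \<open>r > 1\<close>, hence
    \<open>x < 1\<close>, and so keeps the point inside the square.\<close>
  define r where "r = (\<bar>B\<bar> + 1 + a) / a"
  define x where "x = r powr (- 1 / t)"
  have t: "t > 0" and r: "r > 1"
    using assms a by (auto simp: t_def r_def)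
  have x: "0 < x" "x < 1"
    using r t powr_less_mono[of "- 1 / t" 0 r] by (auto simp: x_def)
  have "x powr - t = r"
    using r t by (simp add: x_def powr_powr)
  moreover have "(x ^ 2) powr (- 1 + s) = x powr - t"
    using x by (simp add: t_def power2_powr algebra_simps)
  ultimately have "riesz_fundamental s (x, 0) = \<bar>B\<bar> + 1 + a"
    using a by (simp add: riesz_fundamental_def r_def flip: a_def)
  moreover have "(x, 0) \<in> Omega2 - {(0, 0)}"
    using x by (auto simp: Omega2_def)
  ultimately show False
    using B [of "(x, 0)"] a by auto
qed

section \<open>Pointwise convergence away from the origin\<close>

lemma abs_odd_cos_le: "\<bar>odd_cos l x\<bar> \<le> 1"
  by (simp add: odd_cos_def)

lemma continuous_on_odd_cos [continuous_intros]:
  fixes f :: "'a :: t2_space \<Rightarrow> real"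
  shows "continuous_on A f \<Longrightarrow> continuous_on A (\<lambda>x. odd_cos l (f x))"
  unfolding odd_cos_def by (auto intro!: continuous_intros)

lemma sin_mult_odd_cos:
  "2 * sin (pi * y / 2) * odd_cos (real m) y = sin ((real m + 1) * pi * y) - sin (real m * pi * y)"
proof -
  have "(real m + 1) * pi * y = (2 * real m + 1) * pi * y / 2 + pi * y / 2"
    and "real m * pi * y = (2 * real m + 1) * pi * y / 2 - pi * y / 2"
    by (simp_all add: field_simps)
  then show ?thesis
    by (simp only: sin_add sin_diff odd_cos_def) simp
qed

text \<open>Summation by parts after \<open>sin_mult_odd_cos\<close> has turned the cosines into
  differences of sines; the boundary term at index 0 vanishes with \<open>sin 0\<close>.\<close>

lemma abel_sum_odd_cos:
  fixes a :: "nat \<Rightarrow> real"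
  shows "2 * sin (pi * y / 2) * (\<Sum>m<M. a m * odd_cos m y)
    = (\<Sum>m<M. (a m - a (Suc m)) * sin ((real m + 1) * pi * y)) + a M * sin (real M * pi * y)"
proof (induction M)
  case (Suc M)
  have "2 * sin (pi * y / 2) * (\<Sum>m<Suc M. a m * odd_cos m y)
      = 2 * sin (pi * y / 2) * (\<Sum>m<M. a m * odd_cos m y)
        + a M * (2 * sin (pi * y / 2) * odd_cos M y)"
    by (simp add: algebra_simps)
  also have "\<dots> = (\<Sum>m<Suc M. (a m - a (Suc m)) * sin ((real m + 1) * pi * y))
      + a (Suc M) * sin (real (Suc M) * pi * y)"
    unfolding Suc.IH sin_mult_odd_cos by (simp add: algebra_simps)
  finally show ?case .
qed simp

text \<open>Limit of \<open>2 * sin (pi * y / 2)\<close> times the column sums. The factor is not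
  divided out, so that the function is defined and continuous at its zeros too.\<close>

definition abel_series :: "(nat \<Rightarrow> real) \<Rightarrow> real \<Rightarrow> real" where
  "abel_series a y = (\<Sum>m. (a m - a (Suc m)) * sin ((real m + 1) * pi * y))"

context
  fixes a :: "nat \<Rightarrow> real"
  assumes decseq: "decseq a" and null: "a \<longlonglongrightarrow> 0"
begin

private lemma norm_abel_term:
  "norm ((a m - a (Suc m)) * sin ((real m + 1) * pi * y)) \<le> a m - a (Suc m)"
  using decseq_SucD [OF decseq, of m] by (simp add: abs_mult mult_left_le)

private lemma abel_majorant_sums: "(\<lambda>m. a m - a (Suc m)) sums a 0"
  using telescope_sums' [OF null] by simp

text \<open>The differences contribute at most \<open>a 0 - a M\<close> and the boundary term at
  most \<open>a M\<close>, so the bound depends neither on \<open>M\<close> nor on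
  \<open>y\<close>.\<close>

lemma abs_abel_sum_le: "\<bar>2 * sin (pi * y / 2) * (\<Sum>m<M. a m * odd_cos m y)\<bar> \<le> a 0"
proof -
  have "a M \<ge> 0"
    using decseq null by (rule decseq_ge)
  then have "\<bar>a M * sin (real M * pi * y)\<bar> \<le> a M"
    by (simp add: abs_mult mult_left_le)
  moreover have "\<bar>\<Sum>m<M. (a m - a (Suc m)) * sin ((real m + 1) * pi * y)\<bar> \<le> (\<Sum>m<M. a m - a (Suc m))"
    using norm_abel_term by (intro order_trans [OF sum_abs sum_mono]) auto
  moreover have "(\<Sum>m<M. a m - a (Suc m)) = a 0 - a M"
    by (rule sum_lessThan_telescope')
  ultimately show ?thesis
    unfolding abel_sum_odd_cos by linarith
qed

lemma abel_sum_tendsto: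
  "(\<lambda>M. 2 * sin (pi * y / 2) * (\<Sum>m<M. a m * odd_cos m y)) \<longlonglongrightarrow> abel_series a y"
proof -
  have "summable (\<lambda>m. (a m - a (Suc m)) * sin ((real m + 1) * pi * y))"
    by (rule summable_comparison_test' [OF sums_summable [OF abel_majorant_sums] norm_abel_term])
  then have "(\<lambda>M. \<Sum>m<M. (a m - a (Suc m)) * sin ((real m + 1) * pi * y)) \<longlonglongrightarrow> abel_series a y"
    unfolding abel_series_def by (rule summable_LIMSEQ)
  moreover have "(\<lambda>M. a M * sin (real M * pi * y)) \<longlonglongrightarrow> 0"
  proof (rule tendsto_0_le [OF null])
    show "\<forall>\<^sub>F M in sequentially. norm (a M * sin (real M * pi * y)) \<le> norm (a M) * 1"
      by (auto simp: abs_mult mult_left_le)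
  qed
  ultimately have "(\<lambda>M. (\<Sum>m<M. (a m - a (Suc m)) * sin ((real m + 1) * pi * y))
      + a M * sin (real M * pi * y)) \<longlonglongrightarrow> abel_series a y + 0"
    by (rule tendsto_add)
  then show ?thesis
    unfolding abel_sum_odd_cos by simp
qed

lemma abs_abel_series_le: "\<bar>abel_series a y\<bar> \<le> a 0"
  by (rule LIMSEQ_le_const2 [OF tendsto_rabs [OF abel_sum_tendsto]]) (use abs_abel_sum_le in blast)

lemma continuous_on_abel_series: "continuous_on UNIV (abel_series a)"
proof (rule uniform_limit_theorem)
  show "uniform_limit UNIV (\<lambda>M y. \<Sum>m<M. (a m - a (Suc m)) * sin ((real m + 1) * pi * y))
      (abel_series a) sequentially"
    unfolding abel_series_def [abs_def]
    by (rule Weierstrass_m_test [OF norm_abel_term sums_summable [OF abel_majorant_sums]])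
qed (auto intro!: always_eventually continuous_intros)

end

lemma w_coeff_tendsto_0:
  assumes "s > 0"
  shows "(\<lambda>m. w_coeff s u (real m)) \<longlonglongrightarrow> 0"
proof -
  have "filterlim (\<lambda>m. real m + 1) at_top sequentially"
    by (rule filterlim_at_top_mono [OF filterlim_real_sequentially]) auto
  then have "(\<lambda>m. (real m + 1) powr (- 2 * s)) \<longlonglongrightarrow> 0"
    using assms by (intro tendsto_neg_powr) auto
  then show ?thesis
  proof (rule tendsto_0_le)
    show "\<forall>\<^sub>F m in sequentially. norm (w_coeff s u (real m))
        \<le> norm ((real m + 1) powr (- 2 * s)) * (2 / pi) powr (2 * s)"
    proof (rule always_eventually, rule allI)
      fix m
      have "w_coeff s u (real m) \<le> (2 / pi) powr (2 * s) * (real m + 1) powr (- 2 * s)"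
        using assms by (subst w_coeff_commute) (intro w_coeff_le_powr, auto)
      then show "norm (w_coeff s u (real m)) \<le> norm ((real m + 1) powr (- 2 * s)) * (2 / pi) powr (2 * s)"
        by (simp add: w_coeff_nonneg mult.commute)
    qed
  qed
qed

lemma decseq_w_coeff: "s > 0 \<Longrightarrow> decseq (\<lambda>m. w_coeff s (real k) (real m))"
  by (auto simp: decseq_def intro!: w_coeff_antimono)

text \<open>For \<open>s > 1 / 2\<close> this is \<open>2 * sin (pi * y / 2)\<close> times the
  cosine series, with the sum over \<open>m\<close> carried out first.\<close>

definition w_sin_series :: "real \<Rightarrow> real \<Rightarrow> real \<Rightarrow> real" where
  "w_sin_series s x y = (\<Sum>k. odd_cos (real k) x * abel_series (\<lambda>m. w_coeff s (real k) (real m)) y)"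

text \<open>The leading coefficients of the columns are the majorant both for uniform convergence
  and for Tannery's theorem; their exponent \<open>2 * s\<close> exceeds 1.\<close>

lemma summable_w_coeff_0:
  assumes "s > 1 / 2"
  shows "summable (\<lambda>k. w_coeff s (real k) 0)"
proof (rule summable_comparison_test')
  have "summable (\<lambda>k. real (Suc k) powr (- 2 * s))"
    using assms by (subst summable_Suc_iff) (simp add: summable_real_powr_iff)
  then show "summable (\<lambda>k. (2 / pi) powr (2 * s) * (real k + 1) powr (- 2 * s))"
    by (intro summable_mult) (simp add: add.commute)
  show "norm (w_coeff s (real k) 0) \<le> (2 / pi) powr (2 * s) * (real k + 1) powr (- 2 * s)" for k
    using assms w_coeff_le_powr [of s "real k" 0] w_coeff_nonneg [of s "real k" 0] by auto
qed

lemma continuous_on_w_sin_series: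
  assumes "s > 1 / 2"
  shows "continuous_on UNIV (\<lambda>(x, y). w_sin_series s x y)"
proof (rule uniform_limit_theorem)
  define g where "g = (\<lambda>k (p :: real \<times> real). odd_cos (real k) (fst p)
    * abel_series (\<lambda>m. w_coeff s (real k) (real m)) (snd p))"
  have "\<bar>g k p\<bar> \<le> w_coeff s (real k) 0" for k p
  proof -
    have "\<bar>abel_series (\<lambda>m. w_coeff s (real k) (real m)) (snd p)\<bar> \<le> w_coeff s (real k) 0"
      using abs_abel_series_le [OF decseq_w_coeff w_coeff_tendsto_0, of s k "snd p"] assms by simp
    then have "\<bar>g k p\<bar> \<le> 1 * w_coeff s (real k) 0"
      unfolding g_def abs_mult by (intro mult_mono abs_odd_cos_le) auto
    then show ?thesis by simp
  qed
  moreover have "(\<lambda>(x, y). w_sin_series s x y) = (\<lambda>p. \<Sum>k. g k p)"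
    by (auto simp: w_sin_series_def g_def)
  ultimately show "uniform_limit UNIV (\<lambda>n p. \<Sum>k<n. g k p) (\<lambda>(x, y). w_sin_series s x y) sequentially"
    using summable_w_coeff_0 [OF assms] by (simp only:) (intro Weierstrass_m_test, auto)
  have "continuous_on UNIV (g k)" for k
  proof -
    have "continuous_on UNIV (\<lambda>p :: real \<times> real. abel_series (\<lambda>m. w_coeff s (real k) (real m)) (snd p))"
      using assms
      by (intro continuous_on_compose2 [OF continuous_on_abel_series [OF decseq_w_coeff w_coeff_tendsto_0]]
          continuous_intros) auto
    then show ?thesis
      unfolding g_def by (intro continuous_intros)
  qed
  then show "\<forall>\<^sub>F n in sequentially. continuous_on UNIV (\<lambda>p. \<Sum>k<n. g k p)"
    by (intro always_eventually allI continuous_on_sum) auto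
qed auto

section \<open>Quarter discs of indices, cut into columns\<close>

definition column_height :: "nat \<Rightarrow> nat \<Rightarrow> nat" where
  "column_height K k = (LEAST m. 2 * K ^ 2 \<le> k ^ 2 + m ^ 2)"

lemma less_column_height_iff: "m < column_height K k \<longleftrightarrow> k ^ 2 + m ^ 2 < 2 * K ^ 2"
proof
  show "k ^ 2 + m ^ 2 < 2 * K ^ 2" if "m < column_height K k"
    using that unfolding column_height_def by (metis not_less_Least not_le)
  \<comment> \<open>The index \<open>2 * K\<close> shows that the set whose least element is taken
    is not empty.\<close>
  have "2 * K ^ 2 \<le> k ^ 2 + (2 * K) ^ 2"
    by (simp add: power2_eq_square)
  then have "2 * K ^ 2 \<le> k ^ 2 + column_height K k ^ 2"
    unfolding column_height_def by (rule LeastI)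
  show "m < column_height K k" if "k ^ 2 + m ^ 2 < 2 * K ^ 2"
  proof (rule ccontr)
    assume "\<not> m < column_height K k"
    then have "column_height K k ^ 2 \<le> m ^ 2"
      by (intro power_mono) auto
    with that \<open>2 * K ^ 2 \<le> k ^ 2 + column_height K k ^ 2\<close> show False
      by linarith
  qed
qed

lemma column_height_eq_0: "2 * K \<le> k \<Longrightarrow> column_height K k = 0"
proof -
  assume "2 * K \<le> k"
  from power_mono [OF this, of 2] have "2 * K ^ 2 \<le> k ^ 2 + 0 ^ 2"
    by (simp add: power_mult_distrib)
  then show ?thesis
    using less_column_height_iff [of 0 K k] by simp
qed

lemma filterlim_column_height: "filterlim (\<lambda>K. column_height K k) at_top sequentially"
  unfolding filterlim_at_top
proof
  fix m
  have "m \<le> column_height K k" if "K > k + m" for K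
  proof -
    have "k ^ 2 < K ^ 2" "m ^ 2 < K ^ 2"
      using that by (auto intro!: power_strict_mono)
    then have "m < column_height K k"
      by (simp add: less_column_height_iff)
    then show ?thesis by simp
  qed
  then show "\<forall>\<^sub>F K in sequentially. m \<le> column_height K k"
    by (rule eventually_mono [OF eventually_gt_at_top [of "k + m"]])
qed

lemma disc_eq_Sigma:
  "{(k, m). k ^ 2 + m ^ 2 < 2 * K ^ 2} = Sigma {..<2 * K} (\<lambda>k. {..<column_height K k})"
proof -
  have "k < 2 * K" if "m < column_height K k" for k m
    using that column_height_eq_0 [of K k] by (cases "k < 2 * K") auto
  then show ?thesis
    by (auto simp flip: less_column_height_iff)
qed

lemma finite_disc: "finite {(k :: nat, m). k ^ 2 + m ^ 2 < 2 * (K :: nat) ^ 2}"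
  by (simp add: disc_eq_Sigma)

text \<open>Columns from \<open>2 * K\<close> on have height 0, so the finite sum can be written as
  a series over all \<open>k\<close>, the form in which the limit and the series can be
  interchanged.\<close>

lemma w_partial_eq_columns:
  "w_partial s K (x, y) = (\<Sum>k. odd_cos k x * (\<Sum>m<column_height K k. w_coeff s k m * odd_cos m y))"
proof -
  have "w_partial s K (x, y)
      = (\<Sum>k<2 * K. \<Sum>m<column_height K k. w_coeff s k m * (odd_cos k x * odd_cos m y))"
    unfolding w_partial_def disc_eq_Sigma
    by (subst sum.Sigma) (auto simp: w_term_eq intro!: sum.cong)
  also have "\<dots> = (\<Sum>k<2 * K. odd_cos k x * (\<Sum>m<column_height K k. w_coeff s k m * odd_cos m y))"
    by (simp add: sum_distrib_left mult_ac)
  also have "\<dots> = (\<Sum>k. odd_cos k x * (\<Sum>m<column_height K k. w_coeff s k m * odd_cos m y))"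
    by (rule suminf_finite [symmetric]) (auto simp: column_height_eq_0)
  finally show ?thesis .
qed

text \<open>Tannery's theorem: each column converges because its height tends to infinity with
  \<open>K\<close>, and the Abel bound dominates it by its first coefficient whatever that height
  is.\<close>

lemma sin_mult_w_partial_tendsto:
  assumes "s > 1 / 2"
  shows "(\<lambda>K. 2 * sin (pi * y / 2) * w_partial s K (x, y)) \<longlonglongrightarrow> w_sin_series s x y"
proof -
  define A where "A = (\<lambda>k K. odd_cos (real k) x
    * (2 * sin (pi * y / 2) * (\<Sum>m<column_height K k. w_coeff s (real k) (real m) * odd_cos m y)))"
  have s: "s > 0" using assms by simp
  have "(\<lambda>K. \<Sum>k. A k K) \<longlonglongrightarrow> w_sin_series s x y"
    unfolding w_sin_series_def
  proof (rule tannerys_theorem [THEN conjunct2, THEN conjunct2])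
    show "A k \<longlonglongrightarrow> odd_cos (real k) x * abel_series (\<lambda>m. w_coeff s (real k) (real m)) y" for k
      unfolding A_def
      by (intro tendsto_mult tendsto_const
          filterlim_compose [OF abel_sum_tendsto [OF decseq_w_coeff w_coeff_tendsto_0] filterlim_column_height] s)
    have "norm (A k K) \<le> w_coeff s (real k) 0" for k K
    proof -
      have "norm (A k K) \<le> 1 * w_coeff s (real k) (real 0)"
        unfolding A_def norm_mult real_norm_def abs_mult [symmetric]
        unfolding abs_mult [of "odd_cos _ _"]
        by (intro mult_mono abs_odd_cos_le abs_abel_sum_le decseq_w_coeff w_coeff_tendsto_0 s) auto
      then show ?thesis by simp
    qed
    then show "\<forall>\<^sub>F (k, K) in at_top \<times>\<^sub>F sequentially. norm (A k K) \<le> w_coeff s (real k) 0"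
      by (intro always_eventually) auto
  qed (use summable_w_coeff_0 [OF assms] in auto)
  moreover have "(\<Sum>k. A k K) = 2 * sin (pi * y / 2) * w_partial s K (x, y)" for K
  proof -
    \<comment> \<open>Only finitely many columns are nonempty, which allows the sine factor to be
      moved into the series.\<close>
    have "summable (\<lambda>k. odd_cos (real k) x * (\<Sum>m<column_height K k. w_coeff s k m * odd_cos m y))"
      by (rule summable_finite [of "{..<2 * K}"]) (auto simp: column_height_eq_0)
    from suminf_mult [OF this, of "2 * sin (pi * y / 2)"] show ?thesis
      unfolding A_def w_partial_eq_columns by (simp add: mult_ac)
  qed
  ultimately show ?thesis by simp
qed

lemma w_partial_commute: "w_partial s K (x, y) = w_partial s K (y, x)"
  unfolding w_partial_def
  by (rule sum.reindex_bij_witness [where i = prod.swap and j = prod.swap])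
     (auto simp: w_term_eq w_coeff_commute mult_ac)

text \<open>Written as \<open>lim\<close> everywhere, so that measurability is inherited from the
  partial sums; the value is meaningful only where these converge.\<close>

definition w_value :: "real \<Rightarrow> real \<times> real \<Rightarrow> real" where
  "w_value s p = lim (\<lambda>K. w_partial s K p)"

text \<open>The complement consists of the points with two even integer coordinates.\<close>

definition noncritical :: "(real \<times> real) set" where
  "noncritical = {(x, y). sin (pi * x / 2) \<noteq> 0 \<or> sin (pi * y / 2) \<noteq> 0}"

lemma w_partial_tendsto_quotient:
  assumes "s > 1 / 2" "sin (pi * y / 2) \<noteq> 0"
  shows "(\<lambda>K. w_partial s K (x, y)) \<longlonglongrightarrow> w_sin_series s x y / (2 * sin (pi * y / 2))"
    and "(\<lambda>K. w_partial s K (y, x)) \<longlonglongrightarrow> w_sin_series s x y / (2 * sin (pi * y / 2))"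
proof -
  show "(\<lambda>K. w_partial s K (x, y)) \<longlonglongrightarrow> w_sin_series s x y / (2 * sin (pi * y / 2))"
    using tendsto_divide [OF sin_mult_w_partial_tendsto [OF assms(1), of y x] tendsto_const [of "2 * sin (pi * y / 2)"]]
      assms(2) by simp
  then show "(\<lambda>K. w_partial s K (y, x)) \<longlonglongrightarrow> w_sin_series s x y / (2 * sin (pi * y / 2))"
    by (subst w_partial_commute)
qed

lemma w_partial_tendsto_value:
  assumes "s > 1 / 2" "p \<in> noncritical"
  shows "(\<lambda>K. w_partial s K p) \<longlonglongrightarrow> w_value s p"
proof -
  obtain x y where p: "p = (x, y)" by (cases p)
  have "convergent (\<lambda>K. w_partial s K p)"
    using assms(2) w_partial_tendsto_quotient(1) [OF assms(1), of y x]
      w_partial_tendsto_quotient(2) [OF assms(1), of x y]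
    unfolding p noncritical_def convergent_def by blast
  then show ?thesis
    unfolding w_value_def by (simp add: convergent_LIMSEQ_iff)
qed

text \<open>Each sine has an open set on which it does not vanish, and there the value is a quotient
  of continuous functions; continuity on the union of the two open sets follows.\<close>

lemma continuous_on_w_value:
  assumes s: "s > 1 / 2"
  shows "continuous_on noncritical (w_value s)"
proof -
  have H: "continuous_on UNIV (\<lambda>p. w_sin_series s (fst p) (snd p))"
    using continuous_on_w_sin_series [OF s] by (simp add: case_prod_beta)
  define U where "U = {p :: real \<times> real. sin (pi * fst p / 2) \<noteq> 0}"
  define V where "V = {p :: real \<times> real. sin (pi * snd p / 2) \<noteq> 0}"
  have "open U" "open V"
    unfolding U_def V_def by (intro open_Collect_neq continuous_intros; simp)+
  have "continuous_on U (\<lambda>p. w_sin_series s (snd p) (fst p) / (2 * sin (pi * fst p / 2)))"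
    unfolding U_def
    by (intro continuous_intros continuous_on_compose2 [OF H, of _ prod.swap, simplified])
       (auto intro!: continuous_intros simp: prod.swap_def)
  moreover have "w_value s p = w_sin_series s (snd p) (fst p) / (2 * sin (pi * fst p / 2))" if "p \<in> U" for p
    using w_partial_tendsto_quotient(2) [OF s, of "fst p" "snd p"] that
    by (auto simp: w_value_def U_def limI)
  ultimately have U: "continuous_on U (w_value s)"
    by (simp cong: continuous_on_cong)
  have "continuous_on V (\<lambda>p. w_sin_series s (fst p) (snd p) / (2 * sin (pi * snd p / 2)))"
    unfolding V_def
    by (intro continuous_intros continuous_on_subset [OF H]) auto
  moreover have "w_value s p = w_sin_series s (fst p) (snd p) / (2 * sin (pi * snd p / 2))" if "p \<in> V" for p
    using w_partial_tendsto_quotient(1) [OF s, of "snd p" "fst p"] that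
    by (auto simp: w_value_def V_def limI)
  ultimately have V: "continuous_on V (w_value s)"
    by (simp cong: continuous_on_cong)
  have "noncritical = U \<union> V"
    by (auto simp: noncritical_def U_def V_def)
  then show ?thesis
    using continuous_on_open_Un [OF \<open>open U\<close> \<open>open V\<close> U V] by simp
qed

section \<open>The closed square without its centre\<close>

lemma Omega2_eq_box: "Omega2 = box (-1, -1) (1, 1)"
  by (auto simp: Omega2_def box_def Basis_prod_def abs_less_iff)

lemma closure_Omega2: "closure Omega2 = cbox (-1, -1) (1, 1)"
  unfolding Omega2_eq_box by (rule closure_box) (auto simp: box_ne_empty Basis_prod_def)

text \<open>For \<open>\<bar>x\<bar> \<le> 1\<close> the argument \<open>pi * x / 2\<close> stays
  within a quarter period of 0, where the sine vanishes at 0 only.\<close>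

lemma closure_Omega2_subset: "closure Omega2 - {(0, 0)} \<subseteq> noncritical"
proof -
  have zero: "x = 0" if "-1 \<le> x" "x \<le> 1" "sin (pi * x / 2) = 0" for x :: real
  proof (rule ccontr)
    assume "x \<noteq> 0"
    then consider "0 < x" | "0 < - x" by linarith
    then show False
    proof cases
      case 1
      then have "0 < sin (pi * x / 2)"
        using that pi_gt_zero mult_left_mono [of x 1 pi] by (intro sin_gt_zero divide_pos_pos mult_pos_pos; linarith?)
      then show False using that by simp
    next
      case 2
      then have "0 < sin (pi * (- x) / 2)"
        using that pi_gt_zero mult_left_mono [of "- x" 1 pi] by (intro sin_gt_zero mult_pos_pos divide_pos_pos; linarith?)
      then show False using that by simp
    qed
  qed
  show ?thesis
  proof
    fix p assume "p \<in> closure Omega2 - {(0, 0)}"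
    then show "p \<in> noncritical"
      using zero [of "fst p"] zero [of "snd p"]
      by (cases p) (auto simp: closure_Omega2 noncritical_def)
  qed
qed

lemma w_continuous_on_closure:
  assumes "s > 1 / 2"
  shows "w_continuous_on s (closure Omega2 - {(0, 0)})"
  unfolding w_continuous_on_def w_has_value_def
proof (intro exI conjI ballI)
  show "continuous_on (closure Omega2 - {(0, 0)}) (w_value s)"
    using continuous_on_w_value [OF assms] closure_Omega2_subset by (rule continuous_on_subset)
  show "(\<lambda>K. ereal (w_partial s K p)) \<longlonglongrightarrow> ereal (w_value s p)" if "p \<in> closure Omega2 - {(0, 0)}" for p
    using that closure_Omega2_subset w_partial_tendsto_value [OF assms, of p] by auto
qed

section \<open>Divergence at the origin\<close>

lemma w_partial_0_ge: "(\<Sum>k<K. \<Sum>m<K. w_coeff s (real k) (real m)) \<le> w_partial s K (0, 0)"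
proof -
  \<comment> \<open>The factor 2 in the radius condition makes the quarter disc contain the square
    of side \<open>K\<close>.\<close>
  have "{..<K} \<times> {..<K} \<subseteq> {(k, m). k ^ 2 + m ^ 2 < 2 * K ^ 2}"
  proof safe
    fix k m :: nat assume "k < K" "m < K"
    then have "k ^ 2 < K ^ 2" "m ^ 2 < K ^ 2"
      by (auto intro!: power_strict_mono)
    then show "k ^ 2 + m ^ 2 < 2 * K ^ 2" by simp
  qed
  then have "(\<Sum>(k, m)\<in>{..<K} \<times> {..<K}. w_coeff s (real k) (real m))
      \<le> (\<Sum>(k, m)\<in>{(k, m). k ^ 2 + m ^ 2 < 2 * K ^ 2}. w_coeff s (real k) (real m))"
    by (intro sum_mono2 finite_disc) (auto simp: w_coeff_nonneg)
  also have "\<dots> = w_partial s K (0, 0)"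
    unfolding w_partial_def by (intro sum.cong) (auto simp: w_term_eq odd_cos_def)
  finally show ?thesis
    by (simp add: sum.cartesian_product)
qed

lemma w_partial_0_tendsto_PInfty:
  assumes "0 \<le> s" "s \<le> 1"
  shows "(\<lambda>K. ereal (w_partial s K (0, 0))) \<longlonglongrightarrow> \<infinity>"
  using filterlim_at_top_mono [OF filterlim_sum_w_coeff_square [OF assms] always_eventually]
    w_partial_0_ge by (simp add: tendsto_PInfty_eq_at_top)

lemma infsum_w_coeff_eq_PInfty:
  assumes "0 \<le> s" "s \<le> 1"
  shows "ereal ((2 / pi) powr (2 * s)) *
    (\<Sum>\<^sub>\<infinity>(k, m)\<in>UNIV. ereal (1 / ((2 * real k + 1) ^ 2 + (2 * real m + 1) ^ 2) powr s)) = \<infinity>"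
proof -
  define b where "b = (2 / pi) powr (2 * s)"
  have b: "b > 0" by (simp add: b_def)
  define h where "h = (\<lambda>(k, m). 1 / ((2 * real k + 1) ^ 2 + (2 * real m + 1) ^ 2) powr s)"
  have "infsum (\<lambda>i. ereal (h i)) UNIV = \<infinity>"
  proof (rule ereal_top)
    fix B
    \<comment> \<open>The bound is scaled by \<open>b\<close> because \<open>w_coeff\<close>
      contains this prefactor while \<open>h\<close> does not.\<close>
    obtain n where "B * b < (\<Sum>k<n. \<Sum>m<n. w_coeff s (real k) (real m))"
      using filterlim_sum_w_coeff_square [OF assms]
      unfolding filterlim_at_top_dense by (meson eventually_happens sequentially_bot)
    also have "\<dots> = sum h ({..<n} \<times> {..<n}) * b"
      by (simp add: sum.cartesian_product sum_distrib_right h_def w_coeff_def b_def case_prod_beta)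
    finally have "ereal B \<le> ereal (sum h ({..<n} \<times> {..<n}))"
      using b by simp
    also have "\<dots> = (\<Sum>i\<in>{..<n} \<times> {..<n}. ereal (h i))"
      by simp
    also have "\<dots> \<le> infsum (\<lambda>i. ereal (h i)) UNIV"
      by (subst nonneg_infsum_complete) (auto simp: h_def intro!: SUP_upper)
    finally show "ereal B \<le> infsum (\<lambda>i. ereal (h i)) UNIV" .
  qed
  moreover have "(\<lambda>(k, m). ereal (1 / ((2 * real k + 1) ^ 2 + (2 * real m + 1) ^ 2) powr s)) = (\<lambda>i. ereal (h i))"
    by (auto simp: h_def)
  ultimately show ?thesis
    using b unfolding b_def by simp
qed

section \<open>Convergence in the mean\<close>

lemma Omega2_lmeasurable: "Omega2 \<in> lmeasurable"
  by (simp add: Omega2_eq_box)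

lemma sets_Omega2 [measurable, simp]: "Omega2 \<in> sets lebesgue"
  using Omega2_lmeasurable by blast

lemma finite_measure_Omega2: "finite_measure (lebesgue_on Omega2)"
  by (rule finite_measure_lebesgue_on [OF Omega2_lmeasurable])

lemma borel_measurable_continuous_Omega2:
  fixes f :: "real \<times> real \<Rightarrow> real"
  shows "continuous_on UNIV f \<Longrightarrow> f \<in> borel_measurable (lebesgue_on Omega2)"
  by (rule continuous_imp_measurable_on_sets_lebesgue) (auto intro: continuous_on_subset)

lemma integrable_bounded_Omega2:
  fixes f :: "real \<times> real \<Rightarrow> real"
  assumes "f \<in> borel_measurable (lebesgue_on Omega2)" "\<And>p. p \<in> Omega2 \<Longrightarrow> \<bar>f p\<bar> \<le> B"
  shows "integrable (lebesgue_on Omega2) f"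
  using finite_measure_Omega2 assms
  by (intro finite_measure.integrable_const_bound [where B = B]) (auto intro!: AE_I2)

lemma continuous_bounded_Omega2:
  fixes f :: "real \<times> real \<Rightarrow> real"
  assumes "continuous_on UNIV f"
  obtains B where "\<And>p. p \<in> Omega2 \<Longrightarrow> \<bar>f p\<bar> \<le> B"
proof -
  have "compact (f ` cbox (-1, -1) (1, 1))"
    using assms by (intro compact_continuous_image) (auto intro: continuous_on_subset)
  then have "bounded (f ` cbox (-1, -1) (1, 1))"
    by (rule compact_imp_bounded)
  then obtain B where "\<forall>p\<in>cbox (-1, -1) (1, 1). \<bar>f p\<bar> \<le> B"
    unfolding bounded_iff by auto
  then show ?thesis
    using that box_subset_cbox unfolding Omega2_eq_box by blast
qed

lemma integrable_continuous_Omega2: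
  fixes f :: "real \<times> real \<Rightarrow> real"
  assumes "continuous_on UNIV f"
  shows "integrable (lebesgue_on Omega2) f"
  using continuous_bounded_Omega2 [OF assms] integrable_bounded_Omega2
    borel_measurable_continuous_Omega2 [OF assms] by metis

text \<open>Fubini for continuous functions on the closed square, to which the integral over the
  open square is equal.\<close>

lemma integral_product_Omega2:
  fixes u v :: "real \<Rightarrow> real"
  assumes u: "continuous_on UNIV u" and v: "continuous_on UNIV v"
  shows "(LINT p|lebesgue_on Omega2. u (fst p) * v (snd p)) = integral {-1..1} u * integral {-1..1} v"
proof -
  have c: "continuous_on UNIV (\<lambda>p :: real \<times> real. u (fst p) * v (snd p))"
    by (intro continuous_intros continuous_on_compose2 [OF u] continuous_on_compose2 [OF v]) auto
  have "(LINT p|lebesgue_on Omega2. u (fst p) * v (snd p)) = integral Omega2 (\<lambda>p. u (fst p) * v (snd p))"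
    by (rule lebesgue_integral_eq_integral [OF integrable_continuous_Omega2 [OF c]]) simp
  also have "\<dots> = integral (cbox (-1, -1) (1, 1)) (\<lambda>p. u (fst p) * v (snd p))"
    unfolding Omega2_eq_box by (rule integral_open_interval)
  also have "\<dots> = integral (cbox (-1) 1) (\<lambda>x. integral (cbox (-1) 1) (\<lambda>y. u x * v y))"
    by (subst integral_prod_continuous) (auto intro: continuous_on_subset [OF c])
  finally show ?thesis by simp
qed

lemma integral_cos_int:
  "integral {-1..1} (\<lambda>x. cos (real_of_int n * pi * x)) = (if n = 0 then 2 else 0)"
proof (cases "n = 0")
  case False
  define F where "F = (\<lambda>x. sin (real_of_int n * pi * x) / (real_of_int n * pi))"
  have "((\<lambda>x. cos (real_of_int n * pi * x)) has_integral (F 1 - F (-1))) {-1..1}"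
    unfolding F_def using False
    by (intro fundamental_theorem_of_calculus)
       (auto intro!: derivative_eq_intros simp flip: has_real_derivative_iff_has_vector_derivative)
  moreover have "F 1 = 0" "F (-1) = 0"
    by (auto simp: F_def sin_zero_iff_int2)
  ultimately show ?thesis
    using False by (simp add: integral_unique)
qed simp

text \<open>The product splits into cosines of integer frequencies \<open>k - l\<close> and
  \<open>k + l + 1\<close>; the second is never 0, the first only for \<open>k = l\<close>.\<close>

lemma integral_odd_cos_mult:
  "integral {-1..1} (\<lambda>x. odd_cos (real k) x * odd_cos (real l) x) = (if k = l then 1 else 0)"
proof -
  have eq: "odd_cos (real k) x * odd_cos (real l) x =
      (cos (real_of_int (int k - int l) * pi * x) + cos (real_of_int (int k + int l + 1) * pi * x)) / 2" for x
  proof -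
    have "real_of_int (int k - int l) * pi * x = (2 * real k + 1) * pi * x / 2 - (2 * real l + 1) * pi * x / 2"
      and "real_of_int (int k + int l + 1) * pi * x = (2 * real k + 1) * pi * x / 2 + (2 * real l + 1) * pi * x / 2"
      by (simp_all add: field_simps)
    then show ?thesis
      by (simp only: odd_cos_def cos_times_cos)
  qed
  have int: "(\<lambda>x. cos (real_of_int n * pi * x)) integrable_on {-1..1}" for n
    by (intro integrable_continuous_real continuous_intros)
  show ?thesis
    unfolding eq integral_divide using integral_cos_int [of "int k - int l"]
      integral_cos_int [of "int k + int l + 1"]
    by (subst integral_add [OF int int]) auto
qed

text \<open>By \<open>eigfun_odd\<close> these are, up to sign, the eigenfunctions with two odd
  indices.\<close>

definition cos_basis :: "nat \<times> nat \<Rightarrow> real \<times> real \<Rightarrow> real" where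
  "cos_basis i p = odd_cos (real (fst i)) (fst p) * odd_cos (real (snd i)) (snd p)"

lemma continuous_on_cos_basis [continuous_intros]: "continuous_on A (cos_basis i)"
  unfolding cos_basis_def by (intro continuous_intros)

lemma w_term_eq_cos_basis:
  "w_term s i p = w_coeff s (real (fst i)) (real (snd i)) * cos_basis i p"
  by (cases i, cases p) (simp add: w_term_eq cos_basis_def)

lemma orthonormal_cos_basis:
  "(LINT p|lebesgue_on Omega2. cos_basis i p * cos_basis j p) = (if i = j then 1 else 0)"
proof -
  have "(LINT p|lebesgue_on Omega2. cos_basis i p * cos_basis j p)
      = (LINT p|lebesgue_on Omega2.
          (\<lambda>x. odd_cos (real (fst i)) x * odd_cos (real (fst j)) x) (fst p) *
          (\<lambda>y. odd_cos (real (snd i)) y * odd_cos (real (snd j)) y) (snd p))"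
    by (simp add: cos_basis_def mult_ac)
  also have "\<dots> = (if i = j then 1 else 0)"
    by (subst integral_product_Omega2)
       (auto intro!: continuous_intros simp: integral_odd_cos_mult prod_eq_iff)
  finally show ?thesis .
qed

lemma integral_square_cos_sum:
  assumes "finite F"
  shows "(LINT p|lebesgue_on Omega2. (\<Sum>i\<in>F. a i * cos_basis i p) ^ 2) = (\<Sum>i\<in>F. (a i) ^ 2)"
proof -
  have int: "integrable (lebesgue_on Omega2) (\<lambda>p. a i * a j * (cos_basis i p * cos_basis j p))" for i j
    by (intro integrable_continuous_Omega2 continuous_intros)
  have "(LINT p|lebesgue_on Omega2. (\<Sum>i\<in>F. a i * cos_basis i p) ^ 2)
      = (LINT p|lebesgue_on Omega2. (\<Sum>i\<in>F. \<Sum>j\<in>F. a i * a j * (cos_basis i p * cos_basis j p)))"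
    by (simp add: power2_eq_square sum_product mult_ac)
  also have "\<dots> = (\<Sum>i\<in>F. \<Sum>j\<in>F. a i * a j * (LINT p|lebesgue_on Omega2. cos_basis i p * cos_basis j p))"
  proof -
    have "(LINT p|lebesgue_on Omega2. (\<Sum>i\<in>F. \<Sum>j\<in>F. a i * a j * (cos_basis i p * cos_basis j p)))
        = (\<Sum>i\<in>F. LINT p|lebesgue_on Omega2. (\<Sum>j\<in>F. a i * a j * (cos_basis i p * cos_basis j p)))"
      by (rule Bochner_Integration.integral_sum) (intro Bochner_Integration.integrable_sum int)
    also have "\<dots> = (\<Sum>i\<in>F. \<Sum>j\<in>F. LINT p|lebesgue_on Omega2. a i * a j * (cos_basis i p * cos_basis j p))"
      by (intro sum.cong refl Bochner_Integration.integral_sum int)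
    finally show ?thesis by simp
  qed
  also have "\<dots> = (\<Sum>i\<in>F. (a i) ^ 2)"
    using assms by (simp add: orthonormal_cos_basis power2_eq_square if_distrib [of "\<lambda>z. _ * z"] cong: if_cong)
  finally show ?thesis .
qed

section \<open>The pointwise limit as sum in the mean\<close>

lemma in_L2_continuous: "continuous_on UNIV f \<Longrightarrow> in_L2 f"
  unfolding in_L2_def
  by (auto intro!: borel_measurable_continuous_Omega2 integrable_continuous_Omega2 continuous_intros)

lemma w_partial_eq_sum:
  "w_partial s K p = (\<Sum>i\<in>{(k, m). k ^ 2 + m ^ 2 < 2 * K ^ 2}.
     w_coeff s (real (fst i)) (real (snd i)) * cos_basis i p)"
  by (simp add: w_partial_def w_term_eq_cos_basis)

lemma continuous_on_w_partial: "continuous_on A (w_partial s K)"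
  unfolding w_partial_eq_sum [abs_def] by (intro continuous_intros)

lemma borel_measurable_w_value [measurable]: "w_value s \<in> borel_measurable (lebesgue_on Omega2)"
  unfolding w_value_def [abs_def]
  by (intro borel_measurable_lim_metric borel_measurable_continuous_Omega2 continuous_on_w_partial)

lemma AE_w_partial_tendsto:
  assumes "s > 1 / 2"
  shows "AE p in lebesgue_on Omega2. (\<lambda>K. w_partial s K p) \<longlonglongrightarrow> w_value s p"
proof (rule AE_I')
  show "{(0, 0)} \<in> null_sets (lebesgue_on Omega2)"
  proof -
    have "(0, 0) \<in> Omega2" by (simp add: Omega2_def)
    then show ?thesis
      by (simp add: null_sets_restrict_space flip: negligible_iff_null_sets)
  qed
  show "{p \<in> space (lebesgue_on Omega2). \<not> (\<lambda>K. w_partial s K p) \<longlonglongrightarrow> w_value s p} \<subseteq> {(0, 0)}"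
    using w_partial_tendsto_value [OF assms] closure_Omega2_subset closure_subset [of Omega2] by auto
qed

text \<open>The difference is an orthogonal sum over \<open>G - F\<close>, so its squared norm is at
  most the tail beyond \<open>F\<close>. The bound does not depend on \<open>G\<close>, which lets
  \<open>G\<close> exhaust all indices afterwards.\<close>

lemma nn_integral_cos_sum_diff_le:
  assumes "finite F" "F \<subseteq> G" "finite G" "a summable_on UNIV"
    and a: "\<And>i. a i = (b i) ^ 2"
  shows "(\<integral>\<^sup>+ p. ennreal (((\<Sum>i\<in>F. b i * cos_basis i p) - (\<Sum>i\<in>G. b i * cos_basis i p)) ^ 2)
      \<partial>lebesgue_on Omega2) \<le> ennreal (infsum a UNIV - sum a F)"
proof -
  have sq: "((\<Sum>i\<in>F. b i * cos_basis i p) - (\<Sum>i\<in>G. b i * cos_basis i p)) ^ 2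
      = (\<Sum>i\<in>G - F. b i * cos_basis i p) ^ 2" for p
    using assms(1-3) by (simp add: sum_diff power2_commute)
  have "integrable (lebesgue_on Omega2) (\<lambda>p. (\<Sum>i\<in>G - F. b i * cos_basis i p) ^ 2)"
    by (intro integrable_continuous_Omega2 continuous_intros)
  then have "(\<integral>\<^sup>+ p. ennreal ((\<Sum>i\<in>G - F. b i * cos_basis i p) ^ 2) \<partial>lebesgue_on Omega2)
      = ennreal (\<Sum>i\<in>G - F. (b i) ^ 2)"
    using assms(3) by (subst nn_integral_eq_integral) (auto simp: integral_square_cos_sum)
  also have "(\<Sum>i\<in>G - F. (b i) ^ 2) = sum a G - sum a F"
    using assms(1-3) by (simp add: sum_diff a)
  also have "sum a G \<le> infsum a UNIV"
    using assms by (intro finite_sum_le_infsum) auto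
  finally show ?thesis
    unfolding sq by (simp add: ennreal_leI)
qed

lemma eventually_subset_disc:
  assumes "finite F"
  shows "\<forall>\<^sub>F K in sequentially. F \<subseteq> {(k, m). k ^ 2 + m ^ 2 < 2 * K ^ 2}"
proof -
  have "\<forall>\<^sub>F K in sequentially. i \<in> {(k, m). k ^ 2 + m ^ 2 < 2 * K ^ 2}" for i
  proof (rule eventually_mono [OF eventually_gt_at_top [of "fst i + snd i"]])
    fix K assume "fst i + snd i < K"
    then have "fst i ^ 2 < K ^ 2" "snd i ^ 2 < K ^ 2"
      by (auto intro!: power_strict_mono)
    then show "i \<in> {(k, m). k ^ 2 + m ^ 2 < 2 * K ^ 2}"
      by (auto simp: case_prod_beta)
  qed
  then show ?thesis
    unfolding subset_eq using assms by (intro eventually_ball_finite) auto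
qed

text \<open>Fatou's lemma along the quarter discs: almost everywhere the integrand is the limit of
  those with \<open>w_partial s K\<close>, whose integrals obey the tail bound as soon as the disc
  contains \<open>F\<close>.\<close>

lemma nn_integral_w_value_diff_le:
  assumes s: "s > 1 / 2" and F: "finite F"
  defines "a \<equiv> \<lambda>i. w_coeff s (real (fst i)) (real (snd i)) ^ 2"
  shows "(\<integral>\<^sup>+ p. ennreal (((\<Sum>i\<in>F. w_term s i p) - w_value s p) ^ 2) \<partial>lebesgue_on Omega2)
    \<le> ennreal (infsum a UNIV - sum a F)"
proof -
  define u where "u = (\<lambda>K p. ennreal (((\<Sum>i\<in>F. w_term s i p) - w_partial s K p) ^ 2))"
  have "a summable_on UNIV"
    using summable_on_w_coeff [of "2 * s"] s by (simp add: a_def w_coeff_power2 case_prod_unfold)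
  then have le: "integral\<^sup>N (lebesgue_on Omega2) (u K) \<le> ennreal (infsum a UNIV - sum a F)"
    if "F \<subseteq> {(k, m). k ^ 2 + m ^ 2 < 2 * K ^ 2}" for K
    unfolding u_def w_partial_eq_sum w_term_eq_cos_basis using F that
    by (intro nn_integral_cos_sum_diff_le finite_disc) (auto simp: a_def)
  have [measurable]: "w_partial s K \<in> borel_measurable (lebesgue_on Omega2)"
    "(\<lambda>p. \<Sum>i\<in>F. w_term s i p) \<in> borel_measurable (lebesgue_on Omega2)" for K
    unfolding w_term_eq_cos_basis
    by (intro borel_measurable_continuous_Omega2 continuous_on_w_partial continuous_intros)+
  have "(\<integral>\<^sup>+ p. ennreal (((\<Sum>i\<in>F. w_term s i p) - w_value s p) ^ 2) \<partial>lebesgue_on Omega2)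
      = (\<integral>\<^sup>+ p. liminf (\<lambda>K. u K p) \<partial>lebesgue_on Omega2)"
  proof (rule nn_integral_cong_AE)
    show "AE p in lebesgue_on Omega2. ennreal (((\<Sum>i\<in>F. w_term s i p) - w_value s p) ^ 2)
        = liminf (\<lambda>K. u K p)"
      using AE_w_partial_tendsto [OF s]
    proof eventually_elim
      case (elim p)
      have "(\<lambda>K. u K p) \<longlonglongrightarrow> ennreal (((\<Sum>i\<in>F. w_term s i p) - w_value s p) ^ 2)"
        unfolding u_def by (intro tendsto_intros elim)
      then show ?case
        by (simp add: lim_imp_Liminf)
    qed
  qed
  also have "\<dots> \<le> liminf (\<lambda>K. integral\<^sup>N (lebesgue_on Omega2) (u K))"
    by (intro nn_integral_liminf) (simp add: u_def)
  also have "\<dots> \<le> liminf (\<lambda>K. ennreal (infsum a UNIV - sum a F))"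
    by (intro Liminf_mono eventually_mono [OF eventually_subset_disc [OF F]] le)
  finally show ?thesis
    by (simp add: Liminf_const)
qed

lemma in_L2_w_value:
  assumes "s > 1 / 2"
  shows "in_L2 (w_value s)"
  unfolding in_L2_def
proof (intro conjI integrableI_nonneg)
  \<comment> \<open>The case of the empty partial sum bounds the norm of the limit itself.\<close>
  have "(\<integral>\<^sup>+ p. ennreal (w_value s p ^ 2) \<partial>lebesgue_on Omega2) \<le>
      ennreal (\<Sum>\<^sub>\<infinity>i. w_coeff s (real (fst i)) (real (snd i)) ^ 2)"
    using nn_integral_w_value_diff_le [OF assms, of "{}"] by simp
  also have "\<dots> < \<infinity>" by simp
  finally show "(\<integral>\<^sup>+ p. ennreal (w_value s p ^ 2) \<partial>lebesgue_on Omega2) < \<infinity>" .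
qed auto

lemma has_sum_L2_w_value:
  assumes s: "s > 1 / 2"
  shows "has_sum_L2 (w_term s) (w_value s)"
  unfolding has_sum_L2_def
proof (intro conjI allI)
  show "in_L2 (w_term s i)" for i
    unfolding w_term_eq_cos_basis [abs_def] by (intro in_L2_continuous continuous_intros)
  show "in_L2 (w_value s)"
    by (rule in_L2_w_value [OF s])
  define a where "a = (\<lambda>i. w_coeff s (real (fst i)) (real (snd i)) ^ 2)"
  define D where "D = (\<lambda>F p. (\<Sum>i\<in>F. w_term s i p) - w_value s p)"
  have sm: "a summable_on UNIV"
    using summable_on_w_coeff [of "2 * s"] s by (simp add: a_def w_coeff_power2 case_prod_unfold)
  have le: "inner_L2 (D F) (D F) \<le> infsum a UNIV - sum a F" if "finite F" for F
  proof -
    have "(\<lambda>p. \<Sum>i\<in>F. w_term s i p) \<in> borel_measurable (lebesgue_on Omega2)"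
      unfolding w_term_eq_cos_basis by (intro borel_measurable_continuous_Omega2 continuous_intros)
    then have "D F \<in> borel_measurable (lebesgue_on Omega2)"
      unfolding D_def by measurable
    then have "inner_L2 (D F) (D F) = enn2real (\<integral>\<^sup>+ p. ennreal (D F p ^ 2) \<partial>lebesgue_on Omega2)"
      unfolding inner_L2_def power2_eq_square by (intro integral_eq_nn_integral) auto
    also have "\<dots> \<le> enn2real (ennreal (infsum a UNIV - sum a F))"
      using nn_integral_w_value_diff_le [OF s that] unfolding D_def a_def
      by (intro enn2real_mono) auto
    \<comment> \<open>The tail is nonnegative, so \<open>ennreal\<close> does not truncate it to
      0.\<close>
    also have "\<dots> = infsum a UNIV - sum a F"
      using finite_sum_le_infsum [OF sm that] by (simp add: a_def)
    finally show ?thesis .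
  qed
  have "((\<lambda>F. sqrt (infsum a UNIV - sum a F)) \<longlongrightarrow> sqrt (infsum a UNIV - infsum a UNIV)) (finite_subsets_at_top UNIV)"
    using has_sum_infsum [OF sm] unfolding has_sum_def by (intro tendsto_intros)
  then have "((\<lambda>F. sqrt (infsum a UNIV - sum a F)) \<longlongrightarrow> 0) (finite_subsets_at_top UNIV)"
    by simp
  then have "((\<lambda>F. sqrt (inner_L2 (D F) (D F))) \<longlongrightarrow> 0) (finite_subsets_at_top UNIV)"
  proof (rule tendsto_sandwich [OF _ _ tendsto_const, rotated 2])
    show "\<forall>\<^sub>F F in finite_subsets_at_top UNIV. 0 \<le> sqrt (inner_L2 (D F) (D F))"
      by (auto simp: inner_L2_def intro!: always_eventually)
    show "\<forall>\<^sub>F F in finite_subsets_at_top UNIV. sqrt (inner_L2 (D F) (D F)) \<le> sqrt (infsum a UNIV - sum a F)"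
      by (rule eventually_finite_subsets_at_top_weakI) (simp add: le)
  qed
  then show "((\<lambda>F. let d = (\<lambda>p. (\<Sum>i\<in>F. w_term s i p) - w_value s p) in sqrt (inner_L2 d d)) \<longlongrightarrow> 0)
      (finite_subsets_at_top UNIV)"
    by (simp add: D_def Let_def)
qed

text \<open>Finite partial sums that are close to \<open>f\<close> have norms bounded in terms of
  \<open>f\<close>, and by orthonormality these norms are the sums of the squared
  coefficients.\<close>

lemma summable_L2_imp_summable_square:
  assumes "summable_L2 (w_term s)"
  shows "(\<lambda>i. w_coeff s (real (fst i)) (real (snd i)) ^ 2) summable_on UNIV"
proof -
  define a where "a = (\<lambda>i. w_coeff s (real (fst i)) (real (snd i)))"
  define S where "S = (\<lambda>F p. \<Sum>i\<in>F. a i * cos_basis i p)"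
  obtain f where f: "in_L2 f"
    and lim: "((\<lambda>F. sqrt (inner_L2 (\<lambda>p. S F p - f p) (\<lambda>p. S F p - f p))) \<longlongrightarrow> 0) (finite_subsets_at_top UNIV)"
    using assms unfolding summable_L2_def has_sum_L2_def Let_def S_def a_def w_term_eq_cos_basis by blast
  have [measurable]: "f \<in> borel_measurable (lebesgue_on Omega2)"
    and f2: "integrable (lebesgue_on Omega2) (\<lambda>p. (f p) ^ 2)"
    using f by (auto simp: in_L2_def)
  have "\<forall>\<^sub>F F in finite_subsets_at_top UNIV. sqrt (inner_L2 (\<lambda>p. S F p - f p) (\<lambda>p. S F p - f p)) < 1"
    by (rule order_tendstoD(2) [OF lim]) simp
  moreover have "\<forall>\<^sub>F F in finite_subsets_at_top UNIV. finite F"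
    by (rule eventually_finite_subsets_at_top_weakI)
  ultimately have "\<forall>\<^sub>F F in finite_subsets_at_top UNIV.
      (\<Sum>i\<in>F. a i ^ 2) \<le> 2 + 2 * (LINT p|lebesgue_on Omega2. (f p) ^ 2)"
  proof eventually_elim
    case (elim F)
    have [measurable]: "S F \<in> borel_measurable (lebesgue_on Omega2)"
      unfolding S_def by (intro borel_measurable_continuous_Omega2 continuous_intros)
    have S2: "integrable (lebesgue_on Omega2) (\<lambda>p. (S F p) ^ 2)"
      unfolding S_def by (intro integrable_continuous_Omega2 continuous_intros)
    \<comment> \<open>The first inequality yields integrability of the squared difference, the
      second the estimate; distance at most 1 gives the bound
      \<open>2 + 2 * (LINT p|lebesgue_on Omega2. (f p) ^ 2)\<close>.\<close>
    have ineq: "(x - y) ^ 2 \<le> 2 * x ^ 2 + 2 * y ^ 2" "x ^ 2 \<le> 2 * (x - y) ^ 2 + 2 * y ^ 2" for x y :: real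
      using zero_le_power2 [of "x + y"] zero_le_power2 [of "x - 2 * y"]
      by (simp_all add: power2_eq_square algebra_simps)
    have d2: "integrable (lebesgue_on Omega2) (\<lambda>p. (S F p - f p) ^ 2)"
      by (rule Bochner_Integration.integrable_bound [where f = "\<lambda>p. 2 * (S F p) ^ 2 + 2 * (f p) ^ 2"])
         (use S2 f2 ineq in auto)
    have "(\<Sum>i\<in>F. a i ^ 2) = (LINT p|lebesgue_on Omega2. (S F p) ^ 2)"
      unfolding S_def using elim by (simp add: integral_square_cos_sum)
    also have "\<dots> \<le> (LINT p|lebesgue_on Omega2. 2 * (S F p - f p) ^ 2 + 2 * (f p) ^ 2)"
      using S2 d2 f2 ineq by (intro integral_mono) auto
    also have "\<dots> = 2 * (LINT p|lebesgue_on Omega2. (S F p - f p) ^ 2) + 2 * (LINT p|lebesgue_on Omega2. (f p) ^ 2)"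
      using d2 f2 by simp
    also have "(LINT p|lebesgue_on Omega2. (S F p - f p) ^ 2) \<le> 1"
      using elim by (simp add: inner_L2_def power2_eq_square)
    finally show ?case by simp
  qed
  then have "(\<lambda>i. a i ^ 2) summable_on UNIV"
    by (intro nonneg_bounded_partial_sums_imp_summable_on) auto
  then show ?thesis
    by (simp add: a_def)
qed

lemma summable_L2_w_term_iff:
  assumes "s > 0"
  shows "summable_L2 (w_term s) \<longleftrightarrow> s > 1 / 2"
proof
  assume "summable_L2 (w_term s)"
  from summable_L2_imp_summable_square [OF this]
  have "(\<lambda>(k :: nat, m :: nat). w_coeff (2 * s) k m) summable_on UNIV"
    by (simp add: w_coeff_power2 case_prod_unfold)
  then show "s > 1 / 2"
    using not_summable_on_w_coeff [of "2 * s"] assms by (cases "s > 1 / 2") auto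
next
  assume "s > 1 / 2"
  then show "summable_L2 (w_term s)"
    unfolding summable_L2_def using has_sum_L2_w_value by blast
qed

section \<open>Testing with Fejer-type kernels\<close>

text \<open>\<open>odd_cos_kernel N\<close> is \<open>cos (pi * x / 2)\<close> times \<open>N\<close> times the Fejer kernel in \<open>pi * x\<close>; the factor
  \<open>cos (pi * x / 2) \<ge> 0\<close> shifts the frequencies to odd multiples of \<open>pi / 2\<close>.\<close>

definition odd_cos_kernel :: "nat \<Rightarrow> real \<Rightarrow> real" where
  "odd_cos_kernel N x = (\<Sum>i<N. \<Sum>j<N. odd_cos (real i - real j) x)"

definition fejer_sum :: "nat \<Rightarrow> real \<Rightarrow> real" where
  "fejer_sum N x = (\<Sum>i<N. \<Sum>j<N. cos (real_of_int (int i - int j) * pi * x))"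

lemma continuous_on_odd_cos_kernel [continuous_intros]:
  "continuous_on A (odd_cos_kernel N)"
  unfolding odd_cos_kernel_def by (intro continuous_intros)

lemma continuous_on_fejer_sum [continuous_intros]:
  "continuous_on A (fejer_sum N)"
  unfolding fejer_sum_def by (intro continuous_intros)

text \<open>Squared modulus of a sum of \<open>N\<close> exponentials, split into real and imaginary
  part; it makes nonnegativity visible.\<close>

lemma fejer_sum_eq_squares:
  "fejer_sum N x = (\<Sum>i<N. cos (real i * pi * x)) ^ 2 + (\<Sum>i<N. sin (real i * pi * x)) ^ 2"
  by (simp add: fejer_sum_def left_diff_distrib cos_diff power2_eq_square sum_product sum.distrib)

text \<open>By the addition theorem the part with \<open>sin (pi * x / 2)\<close> is antisymmetric
  in \<open>i\<close> and \<open>j\<close> and cancels in the double sum.\<close>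

lemma odd_cos_kernel_eq: "odd_cos_kernel N x = cos (pi * x / 2) * fejer_sum N x"
proof -
  define C where "C = (\<lambda>i. cos (real i * pi * x))"
  define S where "S = (\<lambda>i. sin (real i * pi * x))"
  have "odd_cos (real i - real j) x
      = cos (pi * x / 2) * (C i * C j + S i * S j) - sin (pi * x / 2) * (S i * C j - C i * S j)" for i j
  proof -
    have "(2 * (real i - real j) + 1) * pi * x / 2 = (real i * pi * x - real j * pi * x) + pi * x / 2"
      by (simp add: field_simps)
    then show ?thesis
      by (simp only: odd_cos_def C_def S_def cos_add cos_diff sin_diff) (simp add: mult_ac)
  qed
  then have "odd_cos_kernel N x = cos (pi * x / 2) * (sum C {..<N} * sum C {..<N} + sum S {..<N} * sum S {..<N})
      - sin (pi * x / 2) * (sum S {..<N} * sum C {..<N} - sum C {..<N} * sum S {..<N})"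
    by (simp add: odd_cos_kernel_def sum_product sum_subtractf sum.distrib
        flip: sum_distrib_left)
  then show ?thesis
    by (simp add: fejer_sum_eq_squares C_def S_def power2_eq_square)
qed

lemma odd_cos_kernel_bounds:
  assumes "\<bar>x\<bar> \<le> 1"
  shows "0 \<le> odd_cos_kernel N x" "odd_cos_kernel N x \<le> fejer_sum N x"
proof -
  have "0 \<le> fejer_sum N x"
    by (simp add: fejer_sum_eq_squares)
  moreover have "\<bar>pi * x / 2\<bar> \<le> pi / 2"
    using assms by (simp add: abs_mult)
  then have "0 \<le> cos (pi * x / 2)"
    by (intro cos_ge_zero) (auto simp: abs_le_iff)
  ultimately show "0 \<le> odd_cos_kernel N x" "odd_cos_kernel N x \<le> fejer_sum N x"
    by (auto simp: odd_cos_kernel_eq mult_left_le_one_le)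
qed

text \<open>Only the \<open>N\<close> diagonal pairs have frequency 0.\<close>

lemma integral_fejer_sum: "integral {-1..1} (fejer_sum N) = 2 * real N"
proof -
  have int: "(\<lambda>x. cos (real_of_int n * pi * x)) integrable_on {-1..1}" for n
    by (intro integrable_continuous_real continuous_intros)
  have "integral {-1..1} (fejer_sum N) = (\<Sum>i<N. \<Sum>j<N. if int i - int j = 0 then 2 else 0)"
    unfolding fejer_sum_def [abs_def]
    by (simp only: Henstock_Kurzweil_Integration.integral_sum integrable_sum int finite_lessThan integral_cos_int)
  also have "\<dots> = 2 * real N"
    by simp
  finally show ?thesis .
qed

text \<open>Every difference \<open>d < n\<close> is realised by at least \<open>n\<close> index
  pairs, namely \<open>i = j + d\<close> with \<open>j < n\<close>; the remaining terms are
  nonnegative and are dropped.\<close>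

lemma sum_differences_ge:
  fixes h :: "real \<Rightarrow> real"
  assumes "\<And>u. h u \<ge> 0"
  shows "real n * (\<Sum>d<n. h (real d)) \<le> (\<Sum>i<2 * n. \<Sum>j<2 * n. h (real i - real j))"
proof -
  have "real n * (\<Sum>d<n. h (real d)) = (\<Sum>j<n. \<Sum>d<n. h (real d))"
    by simp
  also have "\<dots> = (\<Sum>j<n. \<Sum>i\<in>{j..<n + j}. h (real i - real j))"
    using sum.shift_bounds_nat_ivl [of "\<lambda>i. h (real i - real _)" 0 _ n]
    by (simp add: lessThan_atLeast0)
  also have "\<dots> \<le> (\<Sum>j<n. \<Sum>i<2 * n. h (real i - real j))"
    using assms by (intro sum_mono sum_mono2) auto
  also have "\<dots> \<le> (\<Sum>j<2 * n. \<Sum>i<2 * n. h (real i - real j))"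
    using assms by (intro sum_mono2) (auto intro!: sum_nonneg)
  also have "\<dots> = (\<Sum>i<2 * n. \<Sum>j<2 * n. h (real i - real j))"
    by (rule sum.swap)
  finally show ?thesis .
qed

lemma sum_w_coeff_differences_ge:
  "real n ^ 2 * (\<Sum>k<n. \<Sum>m<n. w_coeff s (real k) (real m))
    \<le> (\<Sum>i<2 * n. \<Sum>j<2 * n. \<Sum>i'<2 * n. \<Sum>j'<2 * n. w_coeff s (real i - real j) (real i' - real j'))"
proof -
  have "real n ^ 2 * (\<Sum>k<n. \<Sum>m<n. w_coeff s (real k) (real m))
      = real n * (\<Sum>k<n. real n * (\<Sum>m<n. w_coeff s (real k) (real m)))"
    by (simp add: power2_eq_square mult_ac flip: sum_distrib_left)
  also have "\<dots> \<le> real n * (\<Sum>k<n. \<Sum>i'<2 * n. \<Sum>j'<2 * n. w_coeff s (real k) (real i' - real j'))"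
    by (intro mult_left_mono sum_mono sum_differences_ge w_coeff_nonneg) auto
  also have "\<dots> \<le> (\<Sum>i<2 * n. \<Sum>j<2 * n. \<Sum>i'<2 * n. \<Sum>j'<2 * n. w_coeff s (real i - real j) (real i' - real j'))"
    by (rule sum_differences_ge) (auto intro!: sum_nonneg w_coeff_nonneg)
  finally show ?thesis .
qed

text \<open>The odd number \<open>2 * l + 1\<close> changes sign when \<open>l\<close> is replaced
  by \<open>- l - 1\<close>. Cosine and square are even, so a negative index can be traded for a
  natural one.\<close>

lemma odd_index_reflection:
  obtains k :: nat where "\<And>x. odd_cos (of_int l) x = odd_cos (real k) x"
    and "\<And>v. w_coeff s (of_int l) v = w_coeff s (real k) v"
proof (cases "l \<ge> 0")
  case True
  then show ?thesis using that [of "nat l"] by simp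
next
  case False
  then have l: "real_of_int l = - real (nat (- l - 1)) - 1"
    by simp
  have "odd_cos (- u - 1) x = odd_cos u x" for u x
  proof -
    have "(2 * (- u - 1) + 1) * pi * x / 2 = - ((2 * u + 1) * pi * x / 2)"
      by (simp add: field_simps)
    then show ?thesis
      by (simp only: odd_cos_def cos_minus)
  qed
  moreover have "w_coeff s (- u - 1) v = w_coeff s u v" for u v
    by (simp add: w_coeff_def power2_eq_square algebra_simps)
  ultimately show ?thesis
    using that [of "nat (- l - 1)"] by (simp only: l)
qed

text \<open>The sign in the coefficient and that in the eigenfunction cancel, so cosines of all
  integer indices test \<open>g\<close> to positive numbers, as needed for the terms of the
  kernels.\<close>

lemma odd_coefficient_of_expansion:
  assumes sol: "spectral_dirac_solution s c"
    and g: "\<And>k m. k \<ge> 1 \<Longrightarrow> m \<ge> 1 \<Longrightarrow> inner_L2 g (eigfun k m) = c k m"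
  shows "(LINT p|lebesgue_on Omega2. g p * (odd_cos (of_int l) (fst p) * odd_cos (of_int l') (snd p)))
    = w_coeff s (of_int l) (of_int l')"
proof -
  obtain k where k: "\<And>x. odd_cos (of_int l) x = odd_cos (real k) x"
    "\<And>v. w_coeff s (of_int l) v = w_coeff s (real k) v"
    using odd_index_reflection [of l s] by blast
  obtain m where m: "\<And>x. odd_cos (of_int l') x = odd_cos (real m) x"
    "\<And>v. w_coeff s (of_int l') v = w_coeff s (real m) v"
    using odd_index_reflection [of l' s] by blast
  have "(-1) ^ (k + m) * w_coeff s k m = inner_L2 g (eigfun (2 * k + 1) (2 * m + 1))"
    using g [of "2 * k + 1" "2 * m + 1"] by (simp only: solution_odd [OF sol])
  also have "\<dots> = (LINT p|lebesgue_on Omega2. (-1) ^ (k + m) * (g p * (odd_cos k (fst p) * odd_cos m (snd p))))"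
  proof -
    have "eigfun (2 * k + 1) (2 * m + 1) p = (-1) ^ (k + m) * (odd_cos k (fst p) * odd_cos m (snd p))" for p
      using eigfun_odd [of k m "fst p" "snd p"] by simp
    then show ?thesis
      by (simp only: inner_L2_def mult_ac)
  qed
  also have "\<dots> = (-1) ^ (k + m) * (LINT p|lebesgue_on Omega2. g p * (odd_cos k (fst p) * odd_cos m (snd p)))"
    by simp
  finally show ?thesis
    using k m(1) m(2) [of "real k"] by (simp add: w_coeff_commute [of s "real k"])
qed

lemma not_bounded_expansion:
  assumes s: "0 \<le> s" "s \<le> 1" and sol: "spectral_dirac_solution s c"
  shows "\<not> bounded_expansion c"
proof
  assume "bounded_expansion c"
  then obtain g where meas [measurable]: "g \<in> borel_measurable (lebesgue_on Omega2)"
    and bdd: "bounded (g ` Omega2)"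
    and g: "\<And>k m. k \<ge> 1 \<Longrightarrow> m \<ge> 1 \<Longrightarrow> inner_L2 g (eigfun k m) = c k m"
    unfolding bounded_expansion_def by blast
  obtain B where B: "\<And>p. p \<in> Omega2 \<Longrightarrow> \<bar>g p\<bar> \<le> B" "B > 0"
    using bdd unfolding bounded_pos by auto
  have int: "integrable (lebesgue_on Omega2) (\<lambda>p. g p * h p)" if h: "continuous_on UNIV h" for h
  proof -
    obtain D where D: "\<And>p. p \<in> Omega2 \<Longrightarrow> \<bar>h p\<bar> \<le> D"
      using continuous_bounded_Omega2 [OF h] by blast
    have [measurable]: "h \<in> borel_measurable (lebesgue_on Omega2)"
      by (rule borel_measurable_continuous_Omega2 [OF h])
    have "\<bar>g p * h p\<bar> \<le> B * D" if "p \<in> Omega2" for p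
      unfolding abs_mult using B D that by (intro mult_mono) auto
    then show ?thesis
      by (intro integrable_bounded_Omega2) auto
  qed
  \<comment> \<open>The constant comes from \<open>N = 2 * n\<close>: each \<open>fejer_sum\<close>
    has integral \<open>2 * N = 4 * n\<close>, and the square of this is divided by
    \<open>n ^ 2\<close>.\<close>
  have test: "(\<Sum>k<n. \<Sum>m<n. w_coeff s (real k) (real m)) \<le> 16 * B" if n: "n > 0" for n
  proof -
    define N where "N = 2 * n"
    define Q where "Q = (\<lambda>p. odd_cos_kernel N (fst p) * odd_cos_kernel N (snd p))"
    define R where "R = (\<lambda>p. fejer_sum N (fst p) * fejer_sum N (snd p))"
    define e where "e = (\<lambda>i j i' j' (p :: real \<times> real).
      odd_cos (real i - real j) (fst p) * odd_cos (real i' - real j') (snd p))"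
    have cont_R: "continuous_on UNIV R" and cont_Q: "continuous_on UNIV Q"
      unfolding R_def Q_def
      by (intro continuous_intros continuous_on_compose2 [OF continuous_on_fejer_sum [of UNIV]]
          continuous_on_compose2 [OF continuous_on_odd_cos_kernel [of UNIV]]; simp)+
    have cont_e: "continuous_on UNIV (e i j i' j')" for i j i' j'
      unfolding e_def by (intro continuous_intros)
    have Q_eq: "Q p = (\<Sum>i<N. \<Sum>j<N. \<Sum>i'<N. \<Sum>j'<N. e i j i' j' p)" for p
      unfolding Q_def odd_cos_kernel_def e_def by (simp only: sum_distrib_right) (simp only: sum_distrib_left)
    have "real n ^ 2 * (\<Sum>k<n. \<Sum>m<n. w_coeff s (real k) (real m))
        \<le> (\<Sum>i<N. \<Sum>j<N. \<Sum>i'<N. \<Sum>j'<N. w_coeff s (real i - real j) (real i' - real j'))"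
      unfolding N_def by (rule sum_w_coeff_differences_ge)
    also have "\<dots> = (\<Sum>i<N. \<Sum>j<N. \<Sum>i'<N. \<Sum>j'<N. LINT p|lebesgue_on Omega2. g p * e i j i' j' p)"
      using odd_coefficient_of_expansion [OF sol g, of "int _ - int _" "int _ - int _"]
      by (simp add: e_def)
    also have "\<dots> = (LINT p|lebesgue_on Omega2. (\<Sum>i<N. \<Sum>j<N. \<Sum>i'<N. \<Sum>j'<N. g p * e i j i' j' p))"
      by (simp only: Bochner_Integration.integral_sum Bochner_Integration.integrable_sum int [OF cont_e])
    also have "\<dots> = (LINT p|lebesgue_on Omega2. g p * Q p)"
      unfolding Q_eq by (simp add: sum_distrib_left)
    \<comment> \<open>Nonnegativity of \<open>Q\<close> allows \<open>g\<close> to be replaced by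
      its bound \<open>B\<close>; then \<open>Q\<close> gives way to the larger \<open>R\<close>,
      whose integral is explicit.\<close>
    also have "\<dots> \<le> (LINT p|lebesgue_on Omega2. B * R p)"
    proof (rule integral_mono)
      show "integrable (lebesgue_on Omega2) (\<lambda>p. g p * Q p)"
        by (rule int [OF cont_Q])
      show "integrable (lebesgue_on Omega2) (\<lambda>p. B * R p)"
        by (intro integrable_continuous_Omega2 continuous_intros cont_R)
      fix p assume "p \<in> space (lebesgue_on Omega2)"
      then have p: "p \<in> Omega2" "\<bar>fst p\<bar> \<le> 1" "\<bar>snd p\<bar> \<le> 1"
        by (auto simp: Omega2_def)
      have "0 \<le> Q p" "Q p \<le> R p"
        unfolding Q_def R_def using p order_trans [OF odd_cos_kernel_bounds]
        by (intro mult_nonneg_nonneg mult_mono odd_cos_kernel_bounds; simp)+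
      moreover have "g p \<le> B"
        using B(1) [OF p(1)] by simp
      ultimately show "g p * Q p \<le> B * R p"
        using B(2) by (intro order_trans [OF mult_right_mono mult_left_mono]) auto
    qed
    also have "\<dots> = B * (2 * real N) ^ 2"
      unfolding R_def by (simp add: integral_product_Omega2 continuous_on_fejer_sum integral_fejer_sum power2_eq_square)
    also have "\<dots> = real n ^ 2 * (16 * B)"
      by (simp add: N_def power2_eq_square)
    finally show ?thesis
      using n by simp
  qed
  have "\<forall>\<^sub>F n in sequentially. 16 * B < (\<Sum>k<n. \<Sum>m<n. w_coeff s (real k) (real m))"
    using filterlim_sum_w_coeff_square [OF s] by (simp add: filterlim_at_top_dense)
  then have "\<forall>\<^sub>F n in sequentially. False"
    using eventually_gt_at_top [of 0]
  proof eventually_elim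
    case (elim n)
    then show ?case using test [of n] by linarith
  qed
  then show False by simp
qed

text \<open>The first two conjuncts reduce an arbitrary coefficient family solving the equation to
  the cosine series, which justifies stating the others through \<open>w_term\<close>.\<close>

theorem theorem3p3:
  fixes s :: real and c :: "nat \<Rightarrow> nat \<Rightarrow> real"
  assumes s: "s \<in> {0<..<1}"
    and sol: "spectral_dirac_solution s c"
  shows
    "(\<forall>k m p. c (2 * k + 1) (2 * m + 1) * eigfun (2 * k + 1) (2 * m + 1) p = w_term s (k, m) p) \<and>
     (\<forall>k\<ge>1. \<forall>m\<ge>1. even k \<or> even m \<longrightarrow> c k m = 0) \<and>
     (summable_L2 (w_term s) \<longleftrightarrow> s \<in> {1 / 2<..<1}) \<and>
     w_has_value s (0, 0)
       (ereal ((2 / pi) powr (2 * s)) *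
        (\<Sum>\<^sub>\<infinity>(k, m)\<in>UNIV. ereal (1 / ((2 * real k + 1) ^ 2 + (2 * real m + 1) ^ 2) powr s))) \<and>
     ereal ((2 / pi) powr (2 * s)) *
        (\<Sum>\<^sub>\<infinity>(k, m)\<in>UNIV. ereal (1 / ((2 * real k + 1) ^ 2 + (2 * real m + 1) ^ 2) powr s)) = \<infinity> \<and>
     \<not> bounded_expansion c \<and>
     \<not> bounded (riesz_fundamental s ` (Omega2 - {(0, 0)})) \<and>
     (s \<in> {1 / 2<..<1} \<longrightarrow> w_continuous_on s (closure Omega2 - {(0, 0)}))"
proof -
  have "0 < s" "s < 1" "0 \<le> s" "s \<le> 1"
    using s by auto
  note inf = infsum_w_coeff_eq_PInfty [OF \<open>0 \<le> s\<close> \<open>s \<le> 1\<close>]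
  show ?thesis
    unfolding inf
  proof (intro conjI allI impI)
    show "w_has_value s (0, 0) \<infinity>"
      unfolding w_has_value_def by (rule w_partial_0_tendsto_PInfty [OF \<open>0 \<le> s\<close> \<open>s \<le> 1\<close>])
    show "\<not> bounded_expansion c"
      by (rule not_bounded_expansion [OF \<open>0 \<le> s\<close> \<open>s \<le> 1\<close> sol])
    show "\<not> bounded (riesz_fundamental s ` (Omega2 - {(0, 0)}))"
      by (rule unbounded_riesz_fundamental [OF \<open>0 < s\<close> \<open>s < 1\<close>])
    show "c (2 * k + 1) (2 * m + 1) * eigfun (2 * k + 1) (2 * m + 1) p = w_term s (k, m) p" for k m p
      by (rule solution_term [OF sol])
  qed (use s in \<open>simp_all add: solution_even [OF sol] summable_L2_w_term_iff w_continuous_on_closure\<close>)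
qed

end
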